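(* Let $\mathbf F\in\{\mathbf{R},\mathbf{C}\}$, let $\mathcal V$ be an $n$-dimensional Hilbert space over $\mathbf F$, and let $q:\mathcal V\to[0,\infty)$ be a lower semicontinuous quasinorm with quasi-triangle inequality constant $K$. Then there is a self-adjoint positive (definite) linear operator $A$ on $\mathcal V$ such that $$K^{-2n}q(u)\le\|Au\|_{\mathcal V}\le n^{1/2}q(u)\qquad\text{for all }u\in\mathcal V.$$
   Context: A quasinorm on $\mathcal V$ is a map $q:\mathcal V\to[0,\infty)$ with $q(u)=0$ iff $u=0$, $q(\lambda u)=|\lambda|q(u)$ for all scalars $\lambda\in\mathbf F$, and $q(u+v)\le K(q(u)+q(v))$ for all $u,v$, where $K\ge1$ is the quasi-triangle inequality constant. *)

theory Defs
  imports "HOL-Analysis.Analysis"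
begin

text \<open>
  The scalar field \<open>F \<in> {R, C}\<close> is a type of class \<open>rclike\<close>: a real normed field with a
  conjugation. The lemma \<open>rclike_real_or_complex\<close> below shows that real and complex are,
  up to isomorphism respecting norm and conjugation, the only types of this class.
\<close>

class rclike = real_normed_field +
  fixes conjg :: "'a \<Rightarrow> 'a"
  assumes conjg_add: "conjg (x + y) = conjg x + conjg y"
    and conjg_mult: "conjg (x * y) = conjg x * conjg y"
    and conjg_conjg: "conjg (conjg x) = x"
    and conjg_scaleR_one: "conjg (r *\<^sub>R 1) = r *\<^sub>R 1"
    and mult_conjg_scaleR: "x * conjg x = (norm x)\<^sup>2 *\<^sub>R 1"

instantiation real :: rclike
begin
definition conjg_real :: "real \<Rightarrow> real" where "conjg_real x = x"
instance
  by standard (auto simp: conjg_real_def power2_eq_square)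
end

instantiation complex :: rclike
begin
definition conjg_complex :: "complex \<Rightarrow> complex" where "conjg_complex = cnj"
instance
  by standard (auto simp: conjg_complex_def complex_norm_square[symmetric] scaleR_conv_of_real)
end

lemma conjg_of_real: "conjg (of_real r) = (of_real r :: 'f::rclike)"
  by (simp add: of_real_def conjg_scaleR_one)

lemma mult_conjg: "x * conjg x = (of_real ((norm x)\<^sup>2) :: 'f::rclike)"
  by (simp add: of_real_def mult_conjg_scaleR)

lemma conjg_fixed_imp_real:
  fixes x :: "'f::rclike"
  assumes "conjg x = x"
  shows "\<exists>r. x = of_real r"
proof -
  have "(x + 1) * conjg (x + 1) = x * conjg x + (x + conjg x) + 1"
    using conjg_of_real[where 'f='f, of 1] by (simp add: conjg_add algebra_simps)
  then have "2 * x = of_real ((norm (x + 1))\<^sup>2 - (norm x)\<^sup>2 - 1)"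
    unfolding mult_conjg of_real_diff of_real_1 by (simp add: assms)
  then have "x = of_real (((norm (x + 1))\<^sup>2 - (norm x)\<^sup>2 - 1) / 2)"
    by (simp add: field_simps)
  then show ?thesis by blast
qed

lemma rclike_real_or_complex:
  "(\<exists>\<psi> :: real \<Rightarrow> 'f::rclike. bij \<psi> \<and> \<psi> 1 = 1
      \<and> (\<forall>x y. \<psi> (x + y) = \<psi> x + \<psi> y \<and> \<psi> (x * y) = \<psi> x * \<psi> y)
      \<and> (\<forall>x. norm (\<psi> x) = \<bar>x\<bar> \<and> conjg (\<psi> x) = \<psi> x))
   \<or> (\<exists>\<psi> :: complex \<Rightarrow> 'f. bij \<psi> \<and> \<psi> 1 = 1
      \<and> (\<forall>x y. \<psi> (x + y) = \<psi> x + \<psi> y \<and> \<psi> (x * y) = \<psi> x * \<psi> y)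
      \<and> (\<forall>x. norm (\<psi> x) = norm x \<and> conjg (\<psi> x) = \<psi> (cnj x)))"
proof (cases "\<forall>z::'f. conjg z = z")
  case True
  then have "surj (of_real :: real \<Rightarrow> 'f)"
    using conjg_fixed_imp_real by (metis surj_def)
  then have "bij (of_real :: real \<Rightarrow> 'f)"
    by (simp add: bij_def inj_of_real)
  then show ?thesis
    by (intro disjI1 exI[of _ "of_real :: real \<Rightarrow> 'f"]) (simp add: conjg_of_real)
next
  case False
  then obtain w :: 'f where w: "conjg w \<noteq> w" by blast
  have minus: "conjg (- x) = - conjg x" for x :: 'f
    using conjg_mult[of "-1" x] conjg_of_real[where 'f='f, of "-1"] by simp
  have diff: "conjg (x - y) = conjg x - conjg y" for x y :: 'f
    using conjg_add[of x "- y"] minus[of y] by simp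
  define d where "d = w - conjg w"
  have d0: "d \<noteq> 0" using w by (simp add: d_def)
  have cd: "conjg d = - d" by (simp add: d_def diff conjg_conjg)
  define i where "i = of_real (1 / norm d) * d"
  have ci: "conjg i = - i"
    unfolding i_def conjg_mult conjg_of_real cd by simp
  have "norm i = 1" using d0 by (simp add: i_def norm_mult norm_divide)
  then have "- (i * i) = 1"
    using mult_conjg[of i] ci by simp
  then have ii: "i * i = -1"
    by (metis minus_minus)
  define \<psi> where "\<psi> c = of_real (Re c) + of_real (Im c) * i" for c
  have add: "\<psi> (x + y) = \<psi> x + \<psi> y" for x y by (simp add: \<psi>_def algebra_simps)
  have mult: "\<psi> (x * y) = \<psi> x * \<psi> y" for x y
  proof -
    have "\<psi> x * \<psi> y = of_real (Re x * Re y) + of_real (Re x * Im y + Im x * Re y) * i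
        + of_real (Im x * Im y) * (i * i)"
      by (simp add: \<psi>_def algebra_simps)
    then show ?thesis unfolding ii by (simp add: \<psi>_def algebra_simps)
  qed
  have cj: "conjg (\<psi> x) = \<psi> (cnj x)" for x
    by (simp add: \<psi>_def conjg_add conjg_mult conjg_of_real ci)
  have nrm: "norm (\<psi> x) = norm x" for x
  proof -
    have "of_real ((norm (\<psi> x))\<^sup>2) = \<psi> (x * cnj x)"
      by (simp only: mult_conjg[symmetric] cj mult)
    also have "\<dots> = of_real ((norm x)\<^sup>2)"
      unfolding complex_norm_square[symmetric] by (simp add: \<psi>_def)
    finally have "(norm (\<psi> x))\<^sup>2 = (norm x)\<^sup>2" using of_real_eq_iff by blast
    then show ?thesis by simp
  qed
  have one: "\<psi> 1 = 1" by (simp add: \<psi>_def)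
  have "inj \<psi>"
  proof (rule injI)
    fix x y assume "\<psi> x = \<psi> y"
    then have "\<psi> (x - y) = 0" using add[of "x - y" y] by simp
    then have "norm (x - y) = 0" using nrm[of "x - y"] by simp
    then show "x = y" by simp
  qed
  moreover have "\<exists>c. \<psi> c = z" for z
  proof -
    have "conjg (z + conjg z) = z + conjg z" by (simp add: conjg_add conjg_conjg add.commute)
    then obtain r where r: "z + conjg z = of_real r" using conjg_fixed_imp_real by blast
    have "conjg ((z - conjg z) * i) = (z - conjg z) * i"
      by (simp add: conjg_mult diff conjg_conjg ci algebra_simps)
    then obtain s where s: "(z - conjg z) * i = of_real s" using conjg_fixed_imp_real by blast
    have "z - conjg z = - ((z - conjg z) * (i * i))" by (simp add: ii)
    also have "\<dots> = - (of_real s * i)" using s by (simp add: mult.assoc)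
    finally have "(z + conjg z) + (z - conjg z) = of_real r + (- (of_real s * i))" using r by simp
    then have "2 * z = of_real r - of_real s * i" by simp
    then have "z = \<psi> (Complex (r / 2) (- s / 2))" by (simp add: \<psi>_def field_simps)
    then show ?thesis by metis
  qed
  ultimately have "bij \<psi>" by (metis bij_def surj_def)
  then show ?thesis using add mult cj nrm one by blast
qed

text \<open>
  A Hilbert space over \<open>'f\<close>: the topology and the norm are those of the Banach space type
  \<open>'v\<close>, and the norm is induced by the inner product \<open>ip\<close>, which is linear in its first
  argument. Positive definiteness of \<open>ip\<close> follows from \<open>ip_self\<close> and the norm axioms.
\<close>

locale hilbert_space = vector_space smul
  for smul :: "'f::rclike \<Rightarrow> 'v::banach \<Rightarrow> 'v" +
  fixes ip :: "'v \<Rightarrow> 'v \<Rightarrow> 'f"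
  assumes scale_of_real: "smul (of_real r) x = r *\<^sub>R x"
    and ip_add_left: "ip (x + y) z = ip x z + ip y z"
    and ip_scale_left: "ip (smul c x) y = c * ip x y"
    and ip_commute: "ip y x = conjg (ip x y)"
    and ip_self: "ip x x = of_real ((norm x)\<^sup>2)"

definition quasinorm :: "('f::real_normed_field \<Rightarrow> 'v::ab_group_add \<Rightarrow> 'v) \<Rightarrow> real \<Rightarrow> ('v \<Rightarrow> real) \<Rightarrow> bool"
  where "quasinorm smul K q \<longleftrightarrow>
    K \<ge> 1 \<and>
    (\<forall>u. q u \<ge> 0) \<and>
    (\<forall>u. q u = 0 \<longleftrightarrow> u = 0) \<and>
    (\<forall>c u. q (smul c u) = norm c * q u) \<and>
    (\<forall>u v. q (u + v) \<le> K * (q u + q v))"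

definition lower_semicontinuous :: "('v::topological_space \<Rightarrow> real) \<Rightarrow> bool"
  where "lower_semicontinuous q \<longleftrightarrow> (\<forall>u. \<forall>c < q u. \<forall>\<^sub>F v in nhds u. c < q v)"

definition self_adjoint :: "('v \<Rightarrow> 'v \<Rightarrow> 'f) \<Rightarrow> ('v \<Rightarrow> 'v) \<Rightarrow> bool"
  where "self_adjoint ip A \<longleftrightarrow> (\<forall>u v. ip (A u) v = ip u (A v))"

definition positive_definite :: "('v::zero \<Rightarrow> 'v \<Rightarrow> 'f::real_normed_field) \<Rightarrow> ('v \<Rightarrow> 'v) \<Rightarrow> bool"
  where "positive_definite ip A \<longleftrightarrow> (\<forall>u. u \<noteq> 0 \<longrightarrow> (\<exists>r>0. ip (A u) u = of_real r))"

end

theory Submission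
  imports Defs "Jordan_Normal_Form.Determinant"
begin

text \<open>
  Geometrically, the theorem places an ellipsoid \<open>{u. |A u| \<le> 1}\<close> around the unit ball \<open>B\<close> of \<open>q\<close> so
  tightly that shrinking it by \<open>sqrt n\<close> brings it into the closed convex hull of \<open>B\<close>. This is the
  Loewner ellipsoid of \<open>B\<close>, of smallest volume among the ellipsoids containing \<open>B\<close>; the operator of
  the theorem is \<open>sqrt n A\<close>.

  The inner inclusion is the argument of John. If a point \<open>x\<close> with \<open>sqrt n |A x| \<le> 1\<close> lay outside the
  closed hull, a functional \<open>\<langle>_, w\<rangle>\<close> would separate it from \<open>B\<close>: after scaling, \<open>|\<langle>u, w\<rangle>| \<le> q u\<close> for
  all \<open>u\<close> but \<open>|\<langle>x, w\<rangle>| > 1\<close>. So \<open>B\<close> lies in the ellipsoid and in the slab \<open>|\<langle>u, w\<rangle>| \<le> 1\<close>. Writing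
  \<open>w = A y\<close>, the slab is \<open>|\<langle>A u, y\<rangle>| \<le> 1\<close> with \<open>|y| > sqrt n\<close>, and it is then thin enough that a
  suitable ellipsoid containing the intersection has a larger determinant \<open>|det|\<close>, that is, a smaller
  volume (\<open>extremal_functional_bound\<close>). Working over the scalar field, the ellipsoids are invariant
  under phases, so \<open>n\<close> is the dimension over that field, also in the complex case.

  The quasinorm is at most \<open>K\<^sup>2\<^sup>n\<close> on the closed hull. By the conic form of the theorem of Caratheodory,
  a point of the convex hull is a sum of at most \<open>2 n\<close> multiples of points of \<open>B\<close>, \<open>2 n\<close> being a bound
  for the real dimension, and each summand costs one factor \<open>K\<close> (\<open>q_conic_combination\<close>). Lower
  semicontinuity makes the sublevel sets of \<open>q\<close> closed, which carries the bound over to the closure.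

  Only the form \<open>|A u|\<^sup>2\<close> matters for the ellipsoid, so \<open>A\<close> may be multiplied from the left by any unitary
  operator. Among these equivalent choices one with largest real part of the trace is already
  self-adjoint and positive semidefinite (\<open>extremal_self_adjoint\<close>, \<open>extremal_nonneg\<close>), so a positive
  operator is obtained without polar decomposition or square roots. For this reason an extremal
  operator maximises \<open>|det|\<close> first and the trace second.
\<close>

section \<open>Scalars\<close>

lemma conjg_0 [simp]: "conjg 0 = (0::'f::rclike)"
  using conjg_of_real[of 0, where 'f='f] by simp

lemma conjg_1 [simp]: "conjg 1 = (1::'f::rclike)"
  using conjg_of_real[of 1, where 'f='f] by simp

lemma conjg_minus: "conjg (- x) = - conjg (x::'f::rclike)"
  using conjg_add[of x "- x"] by (simp add: eq_neg_iff_add_eq_0 add.commute)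

lemma conjg_diff: "conjg (x - y) = conjg x - conjg (y::'f::rclike)"
  using conjg_add[of x "- y"] by (simp add: conjg_minus)

lemma norm_conjg [simp]: "norm (conjg x) = norm (x::'f::rclike)"
proof (cases "x = 0")
  case False
  have "norm x * norm (conjg x) = norm x * norm x"
    unfolding norm_mult[symmetric] mult_conjg by (simp add: norm_mult power2_eq_square)
  then show ?thesis using False by simp
qed simp

lemma comm_ring_hom_conjg: "comm_ring_hom (conjg :: 'f::rclike \<Rightarrow> 'f)"
  by unfold_locales (simp_all add: conjg_add conjg_mult)

text \<open>The real part. Written through the norm it is real-valued and continuous without appeal
  to the classification of the scalar fields.\<close>

definition re :: "'f::rclike \<Rightarrow> real"
  where "re z = ((norm (z + 1))\<^sup>2 - (norm z)\<^sup>2 - 1) / 2"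

lemma of_real_re: "(of_real (2 * re z) :: 'f::rclike) = z + conjg z"
proof -
  have "(of_real (2 * re z) :: 'f) = of_real ((norm (z + 1))\<^sup>2) - of_real ((norm z)\<^sup>2) - 1"
    by (simp add: re_def field_simps)
  also have "\<dots> = z + conjg z"
    unfolding mult_conjg[symmetric] by (simp add: conjg_add algebra_simps)
  finally show ?thesis .
qed

lemma re_eqI: "z + conjg z = of_real (2 * r) \<Longrightarrow> re (z::'f::rclike) = r"
  using of_real_re[of z] of_real_eq_iff[of "2 * re z" "2 * r", where 'a='f] by simp

lemma re_add: "re (x + y) = re x + re (y::'f::rclike)"
  using of_real_re[of x] of_real_re[of y]
  by (intro re_eqI) (simp add: conjg_add algebra_simps)

lemma re_of_real [simp]: "re (of_real r :: 'f::rclike) = r"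
  by (rule re_eqI) (simp add: conjg_of_real)

lemma re_0 [simp]: "re (0::'f::rclike) = 0"
  using re_of_real[of 0, where 'f='f] by simp

lemma re_of_real_mult: "re (of_real r * x) = r * re (x::'f::rclike)"
proof (rule re_eqI)
  have "of_real r * x + conjg (of_real r * x) = of_real r * (x + conjg x)"
    by (simp add: conjg_mult conjg_of_real algebra_simps)
  then show "of_real r * x + conjg (of_real r * x) = of_real (2 * (r * re x))"
    unfolding of_real_re[symmetric] by simp
qed

lemma re_minus: "re (- x) = - re (x::'f::rclike)"
  using re_of_real_mult[of "-1" x] by simp

lemma re_diff: "re (x - y) = re x - re (y::'f::rclike)"
  using re_add[of x "- y"] by (simp add: re_minus)

lemma re_conjg: "re (conjg x) = re (x::'f::rclike)"
  using of_real_re[of x] by (intro re_eqI) (simp add: conjg_conjg add.commute)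

lemma re_sum: "re (sum f S) = (\<Sum>i\<in>S. re (f i :: 'f::rclike))"
  by (induction S rule: infinite_finite_induct) (simp_all add: re_add)

lemma re_le_norm: "re x \<le> norm (x::'f::rclike)"
proof -
  have "norm (of_real (2 * re x) :: 'f) \<le> norm x + norm (conjg x)"
    unfolding of_real_re by (rule norm_triangle_ineq)
  then have "\<bar>2 * re x\<bar> \<le> 2 * norm x"
    unfolding norm_of_real by simp
  then show ?thesis by linarith
qed

lemma unit_phase: "\<exists>c::'f::rclike. norm c = 1 \<and> c * z = of_real (norm z)"
proof (cases "z = 0")
  case True
  then show ?thesis by (intro exI[of _ 1]) simp
next
  case False
  have "conjg z / of_real (norm z) * z = of_real (norm z)"
    using False mult_conjg[of z] by (simp add: field_simps power2_eq_square)
  moreover have "norm (conjg z / of_real (norm z)) = 1"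
    using False by (simp add: norm_divide)
  ultimately show ?thesis by blast
qed

text \<open>Equality in \<open>re z \<le> |z|\<close>, read off from \<open>|z - |z||\<^sup>2 = 2 |z| (|z| - re z)\<close>.\<close>

lemma norm_le_re_imp_real:
  assumes "norm z \<le> re z"
  shows "z = of_real (norm (z::'f::rclike))"
proof -
  have "(of_real ((norm (z - of_real (norm z)))\<^sup>2) :: 'f)
      = z * conjg z - of_real (norm z) * (z + conjg z) + of_real ((norm z)\<^sup>2)"
    unfolding mult_conjg[of "z - _", symmetric]
    by (simp add: conjg_diff conjg_of_real algebra_simps power2_eq_square)
  also have "\<dots> = of_real (2 * norm z * (norm z - re z))"
    unfolding mult_conjg of_real_re[symmetric] by (simp add: algebra_simps power2_eq_square)
  finally have "(norm (z - of_real (norm z)))\<^sup>2 = 2 * norm z * (norm z - re z)"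
    using of_real_eq_iff by blast
  also have "\<dots> \<le> 0"
    using assms by (simp add: mult_nonneg_nonpos)
  finally show ?thesis by simp
qed

text \<open>The right phase \<open>c\<close> turns \<open>re (c * (x - y))\<close> into \<open>|x - y|\<close>.\<close>

lemma eq_if_re_phases_eq:
  assumes "\<And>c. norm c = 1 \<Longrightarrow> re (c * x) = re (c * y)"
  shows "x = (y::'f::rclike)"
proof -
  obtain c :: 'f where c: "norm c = 1" "c * (x - y) = of_real (norm (x - y))"
    using unit_phase by blast
  have "re (c * (x - y)) = 0"
    using assms[OF c(1)] by (simp add: right_diff_distrib re_diff)
  then show ?thesis using c(2) by simp
qed

lemma compact_cball_rclike: "compact (cball (0::'f::rclike) r)"
proof -
  \<comment> \<open>It suffices to have an additive isometry from a Euclidean space, and \<open>real\<close> or \<open>complex\<close> provides one.\<close>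
  have main: "compact (cball (0::'f) r)"
    if "bij \<psi>" and add: "\<And>x y. \<psi> (x + y) = \<psi> x + \<psi> y" and nrm: "\<And>x. norm (\<psi> x) = norm x"
    for \<psi> :: "'g::euclidean_space \<Rightarrow> 'f"
  proof -
    have "dist (\<psi> x) (\<psi> y) = dist x y" for x y
      using add[of "x - y" y] nrm[of "x - y"] by (simp add: dist_norm)
    then have "continuous_on UNIV \<psi>"
      by (metis continuous_on_iff)
    then have "compact (\<psi> ` cball 0 r)"
      by (intro compact_continuous_image compact_cball) (rule continuous_on_subset, auto)
    also have "\<psi> ` cball 0 r = cball 0 r"
    proof -
      have "y \<in> \<psi> ` cball 0 r" if y: "norm y \<le> r" for y
      proof -
        obtain x where "y = \<psi> x" using \<open>bij \<psi>\<close> by (metis bij_pointE)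
        then show ?thesis using y nrm[of x] by auto
      qed
      then show ?thesis by (auto simp: nrm)
    qed
    finally show ?thesis .
  qed
  from rclike_real_or_complex[where 'f='f] show ?thesis
  proof (elim disjE exE conjE)
    fix \<psi> :: "real \<Rightarrow> 'f" assume "bij \<psi>" 
      "\<forall>x y. \<psi> (x + y) = \<psi> x + \<psi> y \<and> \<psi> (x * y) = \<psi> x * \<psi> y"
      "\<forall>x. norm (\<psi> x) = \<bar>x\<bar> \<and> conjg (\<psi> x) = \<psi> x"
    then show ?thesis by (intro main[of \<psi>]) auto
  next
    fix \<psi> :: "complex \<Rightarrow> 'f" assume "bij \<psi>" 
      "\<forall>x y. \<psi> (x + y) = \<psi> x + \<psi> y \<and> \<psi> (x * y) = \<psi> x * \<psi> y"
      "\<forall>x. norm (\<psi> x) = norm x \<and> conjg (\<psi> x) = \<psi> (cnj x)"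
    then show ?thesis by (intro main[of \<psi>]) auto
  qed
qed

text \<open>Matrices and coordinate vectors are functions on all indices, vanishing outside \<open>I\<close>. Bounded
  sets of them are compact in the product topology, by Tychonoff.\<close>

lemma compact_box:
  "compact {M :: 'i \<Rightarrow> 'f::rclike. (\<forall>i\<in>I. norm (M i) \<le> r) \<and> (\<forall>i. i \<notin> I \<longrightarrow> M i = 0)}"
proof -
  have "compactin (product_topology (\<lambda>i. euclidean) UNIV)
      (PiE UNIV (\<lambda>i. if i \<in> I then cball (0::'f) r else {0}))"
    by (subst compactin_PiE) (auto simp: compact_cball_rclike)
  then have "compact (PiE UNIV (\<lambda>i. if i \<in> I then cball (0::'f) r else {0}))"
    unfolding euclidean_product_topology by simp
  also have "PiE UNIV (\<lambda>i. if i \<in> I then cball (0::'f) r else {0})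
      = {M. (\<forall>i\<in>I. norm (M i) \<le> r) \<and> (\<forall>i. i \<notin> I \<longrightarrow> M i = 0)}"
    by (auto simp: PiE_iff split: if_splits)
  finally show ?thesis .
qed

section \<open>Inner product and orthonormal families\<close>

context hilbert_space
begin

lemma ip_0_left [simp]: "ip 0 y = 0"
  using ip_add_left[of 0 0 y] by simp

lemma ip_minus_left: "ip (- x) y = - ip x y"
  using ip_add_left[of x "- x" y] by (simp add: eq_neg_iff_add_eq_0 add.commute)

lemma ip_diff_left: "ip (x - y) z = ip x z - ip y z"
  using ip_add_left[of x "- y" z] by (simp add: ip_minus_left)

lemma ip_sum_left: "ip (sum f S) y = (\<Sum>i\<in>S. ip (f i) y)"
  by (induction S rule: infinite_finite_induct) (simp_all add: ip_add_left)

lemma ip_0_right [simp]: "ip x 0 = 0"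
  using ip_commute[of x 0] by simp

lemma ip_add_right: "ip x (y + z) = ip x y + ip x z"
  by (simp add: ip_commute[of x] conjg_add ip_add_left conjg_conjg)

lemma ip_diff_right: "ip x (y - z) = ip x y - ip x z"
  by (simp add: ip_commute[of x] conjg_diff ip_diff_left)

lemma ip_scale_right: "ip x (smul c y) = conjg c * ip x y"
  by (metis conjg_mult ip_commute ip_scale_left)

lemma ip_sum_right: "ip y (sum f S) = (\<Sum>i\<in>S. ip y (f i))"
  by (induction S rule: infinite_finite_induct) (simp_all add: ip_add_right)

lemma ip_scaleR_left: "ip (r *\<^sub>R x) y = of_real r * ip x y"
  by (simp add: scale_of_real[symmetric] ip_scale_left)

lemma ip_scaleR_right: "ip x (r *\<^sub>R y) = of_real r * ip x y"
  by (simp add: scale_of_real[symmetric] ip_scale_right conjg_of_real)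

lemma norm_smul: "norm (smul c x) = norm c * norm x"
proof -
  have "(of_real ((norm (smul c x))\<^sup>2) :: 'f) = of_real ((norm c * norm x)\<^sup>2)"
    unfolding ip_self[symmetric] ip_scale_left ip_scale_right
    unfolding ip_self power_mult_distrib of_real_mult mult_conjg[symmetric]
    by (simp add: algebra_simps)
  then have "(norm (smul c x))\<^sup>2 = (norm c * norm x)\<^sup>2"
    using of_real_eq_iff by blast
  then show ?thesis by (simp add: power2_eq_iff_nonneg)
qed

lemma norm_add_sq: "(norm (x + y))\<^sup>2 = (norm x)\<^sup>2 + 2 * re (ip x y) + (norm y)\<^sup>2"
proof -
  have "(of_real ((norm (x + y))\<^sup>2) :: 'f) = ip x x + (ip x y + conjg (ip x y)) + ip y y"
    unfolding ip_self[symmetric] by (simp add: ip_add_left ip_add_right ip_commute[of y x])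
  also have "\<dots> = of_real ((norm x)\<^sup>2 + 2 * re (ip x y) + (norm y)\<^sup>2)"
    unfolding of_real_re[symmetric] by (simp add: ip_self)
  finally show ?thesis using of_real_eq_iff by blast
qed

definition orthonormal :: "nat \<Rightarrow> (nat \<Rightarrow> 'v) \<Rightarrow> bool"
  where "orthonormal k g \<longleftrightarrow> (\<forall>i<k. \<forall>j<k. ip (g i) (g j) = (if i = j then 1 else 0))"

lemma orthonormalD: "orthonormal k g \<Longrightarrow> i < k \<Longrightarrow> j < k \<Longrightarrow> ip (g i) (g j) = (if i = j then 1 else 0)"
  by (simp add: orthonormal_def)

lemma ip_combination_orthonormal:
  assumes "orthonormal k g" "j < k"
  shows "ip (\<Sum>i<k. smul (c i) (g i)) (g j) = c j"
proof -
  have "ip (\<Sum>i<k. smul (c i) (g i)) (g j) = (\<Sum>i<k. if i = j then c j else 0)"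
    unfolding ip_sum_left ip_scale_left
    by (rule sum.cong) (use assms in \<open>auto simp: orthonormal_def\<close>)
  then show ?thesis using assms by simp
qed

lemma norm_combination_orthonormal:
  assumes "orthonormal k g"
  shows "(norm (\<Sum>i<k. smul (c i) (g i)))\<^sup>2 = (\<Sum>i<k. (norm (c i))\<^sup>2)"
proof -
  have "(of_real ((norm (\<Sum>i<k. smul (c i) (g i)))\<^sup>2) :: 'f)
      = (\<Sum>j<k. conjg (c j) * ip (\<Sum>i<k. smul (c i) (g i)) (g j))"
    unfolding ip_self[symmetric] by (subst ip_sum_right) (simp add: ip_scale_right)
  also have "\<dots> = (\<Sum>j<k. conjg (c j) * c j)"
    by (rule sum.cong) (use assms in \<open>auto simp: ip_combination_orthonormal\<close>)
  also have "\<dots> = of_real (\<Sum>j<k. (norm (c j))\<^sup>2)"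
    unfolding of_real_sum mult_conjg[symmetric] by (simp add: mult.commute)
  finally show ?thesis using of_real_eq_iff by blast
qed

lemma ip_orthogonal_residual:
  assumes "orthonormal k g" "j < k"
  shows "ip (x - (\<Sum>i<k. smul (ip x (g i)) (g i))) (g j) = 0"
  using ip_combination_orthonormal[OF assms, of "\<lambda>i. ip x (g i)"] by (simp add: ip_diff_left)

text \<open>Pythagoras for the projection of \<open>x\<close> onto an orthonormal family. It yields both the Cauchy-Schwarz
  inequality (one vector) and Parseval's identity (an orthonormal basis).\<close>

lemma bessel_eq:
  assumes "orthonormal k g"
  shows "(norm x)\<^sup>2 = (norm (x - (\<Sum>i<k. smul (ip x (g i)) (g i))))\<^sup>2 + (\<Sum>i<k. (norm (ip x (g i)))\<^sup>2)"
proof -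
  define s where "s = (\<Sum>i<k. smul (ip x (g i)) (g i))"
  have "ip (x - s) s = (\<Sum>j<k. conjg (ip x (g j)) * ip (x - s) (g j))"
    unfolding s_def by (subst ip_sum_right) (simp add: ip_scale_right)
  also have "\<dots> = 0"
    using assms by (simp add: s_def ip_orthogonal_residual)
  finally have "(norm (x - s + s))\<^sup>2 = (norm (x - s))\<^sup>2 + (norm s)\<^sup>2"
    unfolding norm_add_sq by simp
  then show ?thesis
    using norm_combination_orthonormal[OF assms, of "\<lambda>i. ip x (g i)"] by (simp add: s_def)
qed

lemma ip_unit_self: "norm v = 1 \<Longrightarrow> ip v v = 1"
  by (simp add: ip_self)

lemma norm_unit_iff: "ip v v = 1 \<longleftrightarrow> norm v = 1"
proof
  assume "ip v v = 1"
  then have "(of_real ((norm v)\<^sup>2) :: 'f) = of_real 1" by (simp add: ip_self)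
  then have "(norm v)\<^sup>2 = 1" using of_real_eq_iff by blast
  then show "norm v = 1" by (simp add: power2_eq_1_iff) (use norm_ge_zero[of v] in linarith)
qed (rule ip_unit_self)

lemma cauchy_schwarz: "norm (ip x y) \<le> norm x * norm y"
proof (cases "y = 0")
  case False
  define e where "e = (1 / norm y) *\<^sub>R y"
  have y: "norm y *\<^sub>R e = y" using False by (simp add: e_def)
  have "norm e = 1" using False by (simp add: e_def)
  then have "orthonormal 1 (\<lambda>_. e)" by (simp add: orthonormal_def ip_unit_self)
  have "(norm (ip x e))\<^sup>2 \<le> (norm x)\<^sup>2"
    unfolding bessel_eq[OF \<open>orthonormal 1 (\<lambda>_. e)\<close>, of x] by simp
  then have "norm (ip x e) \<le> norm x" by (rule power2_le_imp_le) simp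
  moreover have "norm (ip x y) = norm y * norm (ip x e)"
    using ip_scaleR_right[of x "norm y" e] by (simp add: y norm_mult)
  ultimately show ?thesis using mult_left_mono[of "norm (ip x e)" "norm x" "norm y"] by (simp add: mult.commute)
qed simp

end

section \<open>Orthonormal bases and compactness in finite dimension\<close>

text \<open>Over the reals the scalars have dimension at most \<open>2\<close>. When conjugation moves some \<open>w\<close>, a multiple of
  \<open>w - conjg w\<close> is an imaginary unit, so \<open>1\<close> and \<open>w\<close> generate.\<close>

lemma ex_two_real_generators: "\<exists>w::'f::rclike. \<forall>z. \<exists>a b. z = of_real a + of_real b * w"
proof (cases "\<forall>z::'f. conjg z = z")
  case True
  then show ?thesis
    by (intro exI[of _ 0]) (simp add: conjg_fixed_imp_real)
next
  case False
  then obtain w :: 'f where w: "conjg w \<noteq> w" by blast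
  have "\<exists>a b. z = of_real a + of_real b * w" for z
  proof -
    \<comment> \<open>A quotient of two purely imaginary numbers is real.\<close>
    define c where "c = (z - conjg z) / (w - conjg w)"
    have c: "c * (w - conjg w) = z - conjg z" using w by (simp add: c_def)
    then have "conjg (c * (w - conjg w)) = - (c * (w - conjg w))"
      by (simp add: conjg_diff conjg_conjg)
    then have "conjg c * (w - conjg w) = c * (w - conjg w)"
      by (simp add: conjg_mult conjg_diff conjg_conjg algebra_simps)
    then obtain b where b: "c = of_real b" using w conjg_fixed_imp_real[of c] by auto
    have "conjg (z - c * w) = z - c * w"
      using c unfolding b by (simp add: conjg_diff conjg_mult conjg_of_real algebra_simps)
    then obtain a where "z - c * w = of_real a" using conjg_fixed_imp_real by blast
    then show ?thesis unfolding b by (metis diff_eq_eq)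
  qed
  then show ?thesis by blast
qed

locale finite_dim_hilbert_space =
  hilbert_space smul ip + finite_dimensional_vector_space smul Basis
  for smul :: "'f::rclike \<Rightarrow> 'v::banach \<Rightarrow> 'v" and ip :: "'v \<Rightarrow> 'v \<Rightarrow> 'f" and Basis :: "'v set" +
  fixes n :: nat
  assumes dim_eq_n: "dim UNIV = n"
begin

lemma orthonormal_length_le:
  assumes g: "orthonormal k g"
  shows "k \<le> n"
proof -
  have inj: "inj_on g {..<k}"
    using g unfolding orthonormal_def inj_on_def by (metis lessThan_iff zero_neq_one)
  have "independent (g ` {..<k})"
  proof (rule independent_if_scalars_zero)
    fix f x assume 0: "(\<Sum>x\<in>g ` {..<k}. smul (f x) x) = 0" and "x \<in> g ` {..<k}"
    then obtain j where j: "j < k" "x = g j" by auto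
    have "ip (\<Sum>i<k. smul (f (g i)) (g i)) (g j) = 0"
      using 0 by (simp add: sum.reindex[OF inj])
    then show "f x = 0"
      using j by (simp add: ip_combination_orthonormal[OF g, of _ "\<lambda>i. f (g i)"])
  qed simp
  then have "card (g ` {..<k}) \<le> dim UNIV"
    by (intro independent_card_le_dim) auto
  then show ?thesis using inj by (simp only: card_image dim_eq_n card_lessThan)
qed

text \<open>One step of the Gram-Schmidt process.\<close>

lemma orthonormal_Suc:
  assumes g: "orthonormal k g" and x: "x \<noteq> (\<Sum>i<k. smul (ip x (g i)) (g i))"
  shows "\<exists>v. orthonormal (Suc k) (g(k := v))"
proof -
  define y where "y = x - (\<Sum>i<k. smul (ip x (g i)) (g i))"
  define v where "v = (1 / norm y) *\<^sub>R y"
  have "y \<noteq> 0" using x by (simp add: y_def)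
  then have vv: "ip v v = 1" by (intro ip_unit_self) (simp add: v_def)
  have vg: "ip v (g j) = 0" if "j < k" for j
    using ip_orthogonal_residual[OF g that, of x] by (simp add: v_def y_def ip_scaleR_left)
  have "ip (g j) v = 0" if "j < k" for j
    using vg[OF that] ip_commute[of "g j" v] by simp
  then have "orthonormal (Suc k) (g(k := v))"
    using g vv vg by (auto simp: orthonormal_def less_Suc_eq)
  then show ?thesis by blast
qed

lemma orthonormal_extend:
  assumes "orthonormal k g"
  shows "\<exists>h. orthonormal n h \<and> (\<forall>i<k. h i = g i)"
  using assms
proof (induction "n - k" arbitrary: k g)
  case 0
  then show ?case using orthonormal_length_le[of k g] by auto
next
  case (Suc m)
  have "\<exists>x. x \<notin> span (g ` {..<k})"
  proof (rule ccontr)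
    assume "\<nexists>x. x \<notin> span (g ` {..<k})"
    then have "dim UNIV \<le> card (g ` {..<k})" by (intro dim_le_card) auto
    also have "\<dots> \<le> k" using card_image_le[of "{..<k}" g] by simp
    finally show False using Suc.hyps dim_eq_n by simp
  qed
  then obtain x where "x \<notin> span (g ` {..<k})" by blast
  then have "x \<noteq> (\<Sum>i<k. smul (ip x (g i)) (g i))"
    using span_sum[of "{..<k}" "\<lambda>i. smul (ip x (g i)) (g i)" "g ` {..<k}"] span_scale span_base
    by (metis image_eqI)
  then obtain v where v: "orthonormal (Suc k) (g(k := v))"
    using orthonormal_Suc[OF Suc.prems] by blast
  then obtain h where "orthonormal n h" "\<forall>i<Suc k. h i = (g(k := v)) i"
    using Suc.hyps(1)[OF _ v] Suc.hyps(2) by (metis Suc_diff_Suc diff_Suc_1 zero_less_Suc zero_less_diff)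
  then show ?case by (intro exI[of _ h]) auto
qed

lemma unit_vector_extend:
  assumes "norm e = 1"
  obtains g where "orthonormal n g" "g 0 = e" "0 < n"
proof -
  have "orthonormal 1 (\<lambda>_. e)" using assms by (simp add: orthonormal_def ip_unit_self)
  then show ?thesis
    using orthonormal_extend[of 1 "\<lambda>_. e"] orthonormal_length_le[of 1 "\<lambda>_. e"] that by fastforce
qed

lemma dim_pos:
  fixes v :: 'v
  assumes "v \<noteq> 0"
  shows "0 < n"
proof -
  have "norm ((1 / norm v) *\<^sub>R v) = 1" using assms by simp
  then show ?thesis by (rule unit_vector_extend)
qed

lemma orthonormal_expansion:
  assumes "orthonormal n g"
  shows "(\<Sum>i<n. smul (ip x (g i)) (g i)) = x"
proof (rule ccontr)
  assume "\<not> ?thesis"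
  then obtain v where "orthonormal (Suc n) (g(n := v))"
    using orthonormal_Suc[OF assms, of x] by metis
  then show False using orthonormal_length_le by force
qed

lemma parseval:
  assumes "orthonormal n g"
  shows "(\<Sum>i<n. (norm (ip x (g i)))\<^sup>2) = (norm x)\<^sup>2"
  using bessel_eq[OF assms, of x] by (simp add: orthonormal_expansion[OF assms])

lemma ip_expansion:
  assumes "orthonormal n g"
  shows "(\<Sum>i<n. ip x (g i) * ip (g i) y) = ip x y"
proof -
  have "ip (\<Sum>i<n. smul (ip x (g i)) (g i)) y = (\<Sum>i<n. ip x (g i) * ip (g i) y)"
    by (simp add: ip_sum_left ip_scale_left)
  then show ?thesis by (simp add: orthonormal_expansion[OF assms])
qed

definition onb :: "nat \<Rightarrow> 'v"
  where "onb = (SOME g. orthonormal n g)"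

lemma orthonormal_onb: "orthonormal n onb"
proof -
  have "orthonormal 0 g" for g by (simp add: orthonormal_def)
  then have "\<exists>g. orthonormal n g" using orthonormal_extend by blast
  then show ?thesis unfolding onb_def by (rule someI_ex)
qed

lemma ip_onb: "i < n \<Longrightarrow> j < n \<Longrightarrow> ip (onb i) (onb j) = (if i = j then 1 else 0)"
  by (rule orthonormalD[OF orthonormal_onb])

lemma norm_onb: "i < n \<Longrightarrow> norm (onb i) = 1"
  using ip_onb[of i i] by (simp flip: norm_unit_iff)

lemma continuous_on_smul: "continuous_on UNIV (\<lambda>c. smul c x)"
proof -
  have "dist (smul c x) (smul d x) \<le> dist c d * norm x" for c d
    by (simp add: dist_norm norm_smul scale_left_diff_distrib[symmetric])
  then have "(norm x)-lipschitz_on UNIV (\<lambda>c. smul c x)"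
    by (intro lipschitz_onI) (simp_all add: mult.commute)
  then show ?thesis by (rule lipschitz_on_continuous_on)
qed

text \<open>Heine-Borel for the abstract space: a ball is a closed subset of the image of a box of coordinate
  vectors.\<close>

lemma compact_cball_space: "compact (cball (0::'v) r)"
proof -
  define box where "box = {c :: nat \<Rightarrow> 'f. (\<forall>i\<in>{..<n}. norm (c i) \<le> r) \<and> (\<forall>i. i \<notin> {..<n} \<longrightarrow> c i = 0)}"
  define \<Phi> where "\<Phi> c = (\<Sum>i<n. smul (c i) (onb i))" for c
  have "continuous_on UNIV \<Phi>"
    unfolding \<Phi>_def
    by (intro continuous_on_sum continuous_on_compose2[OF continuous_on_smul]) auto
  then have "compact (\<Phi> ` box)"
    unfolding box_def
    by (intro compact_continuous_image compact_box) (rule continuous_on_subset, auto)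
  then have "compact (\<Phi> ` box \<inter> cball 0 r)"
    by (intro compact_Int_closed closed_cball)
  moreover have "x \<in> \<Phi> ` box" if "norm x \<le> r" for x
  proof (rule image_eqI)
    have "norm (ip x (onb i)) \<le> r" if "i < n" for i
      using cauchy_schwarz[of x "onb i"] \<open>norm x \<le> r\<close> norm_onb[OF that] by simp
    then show "(\<lambda>i. if i < n then ip x (onb i) else 0) \<in> box"
      by (simp add: box_def)
    show "x = \<Phi> (\<lambda>i. if i < n then ip x (onb i) else 0)"
      using orthonormal_expansion[OF orthonormal_onb, of x] by (simp add: \<Phi>_def)
  qed
  then have "\<Phi> ` box \<inter> cball 0 r = cball 0 r" by auto
  ultimately show ?thesis by simp
qed

text \<open>The source of the factor \<open>2\<close> in the exponent of \<open>K\<close>: a basis \<open>e\<^sub>i\<close> over the scalar field gives the real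
  generators \<open>e\<^sub>i\<close> and \<open>w e\<^sub>i\<close>.\<close>

lemma real_independent_card_le:
  fixes S :: "'v set"
  assumes "finite S" "\<not> Real_Vector_Spaces.dependent S"
  shows "card S \<le> 2 * n"
proof -
  obtain w :: 'f where w: "\<And>z. \<exists>a b. z = of_real a + of_real b * w"
    using ex_two_real_generators by blast
  define T where "T = onb ` {..<n} \<union> (\<lambda>i. smul w (onb i)) ` {..<n}"
  have "x \<in> real_vector.span T" for x
  proof -
    have "smul z (onb i) \<in> real_vector.span T" if "i < n" for z i
    proof -
      obtain a b where "z = of_real a + of_real b * w" using w by blast
      then have "smul z (onb i) = a *\<^sub>R onb i + b *\<^sub>R smul w (onb i)"
        by (simp add: scale_left_distrib scale_of_real[symmetric])
      also have "\<dots> \<in> real_vector.span T"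
        using that by (intro real_vector.span_add real_vector.span_scale real_vector.span_base)
          (auto simp: T_def)
      finally show ?thesis .
    qed
    then have "(\<Sum>i<n. smul (ip x (onb i)) (onb i)) \<in> real_vector.span T"
      by (intro real_vector.span_sum) auto
    then show ?thesis by (simp add: orthonormal_expansion[OF orthonormal_onb])
  qed
  then have "card S \<le> card T"
    using real_vector.independent_span_bound[of T S] assms by (auto simp: T_def)
  also have "\<dots> \<le> card (onb ` {..<n}) + card ((\<lambda>i. smul w (onb i)) ` {..<n})"
    unfolding T_def by (rule card_Un_le)
  also have "\<dots> \<le> n + n"
    by (intro add_mono order_trans[OF card_image_le]) auto
  finally show ?thesis by simp
qed

end

section \<open>Determinant and trace of an operator\<close>

context finite_dim_hilbert_space
begin

abbreviation lin :: "('v \<Rightarrow> 'v) \<Rightarrow> bool"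
  where "lin \<equiv> Vector_Spaces.linear smul smul"

lemma linI: "(\<And>x y. T (x + y) = T x + T y) \<Longrightarrow> (\<And>c x. T (smul c x) = smul c (T x)) \<Longrightarrow> lin T"
  by (simp add: Vector_Spaces.linear_iff vector_space_axioms)

lemma lin_add: "lin T \<Longrightarrow> T (x + y) = T x + T y"
  and lin_smul: "lin T \<Longrightarrow> T (smul c x) = smul c (T x)"
  by (simp_all add: Vector_Spaces.linear_iff)

lemma lin_0: "lin T \<Longrightarrow> T 0 = 0"
  using lin_smul[of T 0 0] by simp

lemma lin_scaleR: "lin T \<Longrightarrow> T (r *\<^sub>R x) = r *\<^sub>R T x"
  using lin_smul[of T "of_real r" x] by (simp add: scale_of_real)

lemma lin_diff: "lin T \<Longrightarrow> T (x - y) = T x - T y"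
  using lin_add[of T "x - y" y] by simp

lemma lin_sum: "lin T \<Longrightarrow> T (sum f S) = (\<Sum>i\<in>S. T (f i))"
  by (induction S rule: infinite_finite_induct) (simp_all add: lin_0 lin_add)

lemma lin_comp: "lin S \<Longrightarrow> lin T \<Longrightarrow> lin (\<lambda>x. S (T x))"
  by (rule linI) (simp_all add: lin_add lin_smul)

lemma lin_expansion:
  assumes "lin T" "orthonormal n g"
  shows "(\<Sum>k<n. smul (ip x (g k)) (T (g k))) = T x"
proof -
  have "T (\<Sum>k<n. smul (ip x (g k)) (g k)) = (\<Sum>k<n. smul (ip x (g k)) (T (g k)))"
    using assms(1) by (simp add: lin_sum lin_smul)
  then show ?thesis by (simp add: orthonormal_expansion[OF assms(2)])
qed

lemma ip_lin_expansion:
  assumes "lin T" "orthonormal n g"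
  shows "(\<Sum>k<n. ip x (g k) * ip (T (g k)) y) = ip (T x) y"
proof -
  have "(\<Sum>k<n. ip x (g k) * ip (T (g k)) y) = ip (\<Sum>k<n. smul (ip x (g k)) (T (g k))) y"
    by (simp add: ip_sum_left ip_scale_left)
  then show ?thesis by (simp add: lin_expansion[OF assms])
qed

definition opdet :: "('v \<Rightarrow> 'v) \<Rightarrow> 'f"
  where "opdet T = Determinant.det (Matrix.mat n n (\<lambda>(i, j). ip (T (onb j)) (onb i)))"

definition optr :: "('v \<Rightarrow> 'v) \<Rightarrow> 'f"
  where "optr T = (\<Sum>i<n. ip (T (onb i)) (onb i))"

lemma opdet_comp:
  assumes "lin S"
  shows "opdet (\<lambda>x. S (T x)) = opdet S * opdet T"
proof -
  define mat where "mat R = Matrix.mat n n (\<lambda>(i, j). ip (R (onb j)) (onb i))" for R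
  have "mat (\<lambda>x. S (T x)) = mat S * mat T"
  proof (rule eq_matI)
    fix i j assume "i < dim_row (mat S * mat T)" "j < dim_col (mat S * mat T)"
    then have ij: "i < n" "j < n" by (simp_all add: mat_def)
    have "ip (S (T (onb j))) (onb i) = (\<Sum>k<n. ip (T (onb j)) (onb k) * ip (S (onb k)) (onb i))"
      by (simp add: ip_lin_expansion[OF assms orthonormal_onb])
    then show "mat (\<lambda>x. S (T x)) $$ (i, j) = (mat S * mat T) $$ (i, j)"
      using ij by (simp add: mat_def scalar_prod_def atLeast0LessThan mult.commute)
  qed (simp_all add: mat_def)
  then show ?thesis
    unfolding opdet_def mat_def[symmetric]
    by (simp add: det_mult[of _ n] mat_def)
qed

lemma opdet_id: "opdet (\<lambda>x. x) = 1"
proof -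
  have "Matrix.mat n n (\<lambda>(i, j). ip (onb j) (onb i)) = 1\<^sub>m n"
    by (rule eq_matI) (simp_all add: ip_onb)
  then show ?thesis by (simp add: opdet_def)
qed

text \<open>The operator taking \<open>g k\<close> to \<open>d k\<close> times \<open>h k\<close>, for orthonormal bases \<open>g\<close> and \<open>h\<close>: a singular value
  decomposition read as a definition. Every modification of an operator below composes it with
  such a map, whose determinant has modulus \<open>\<Prod>k<n. |d k|\<close>.\<close>

definition stretch :: "(nat \<Rightarrow> 'v) \<Rightarrow> (nat \<Rightarrow> 'v) \<Rightarrow> (nat \<Rightarrow> real) \<Rightarrow> 'v \<Rightarrow> 'v"
  where "stretch g h d x = (\<Sum>k<n. smul (of_real (d k) * ip x (g k)) (h k))"

lemma lin_stretch: "lin (stretch g h d)"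
  by (rule linI)
    (simp_all add: stretch_def ip_add_left ip_scale_left distrib_left scale_left_distrib
      sum.distrib scale_sum_right mult.left_commute)

lemma norm_stretch:
  assumes "orthonormal n h"
  shows "(norm (stretch g h d x))\<^sup>2 = (\<Sum>k<n. (d k)\<^sup>2 * (norm (ip x (g k)))\<^sup>2)"
  unfolding stretch_def norm_combination_orthonormal[OF assms]
  by (simp add: norm_mult power_mult_distrib)

lemma ip_stretch:
  assumes "orthonormal n h" "k < n"
  shows "ip (stretch g h d x) (h k) = of_real (d k) * ip x (g k)"
  using ip_combination_orthonormal[OF assms] by (simp add: stretch_def)

lemma stretch_stretch:
  assumes "orthonormal n h"
  shows "stretch h l c (stretch g h d x) = stretch g l (\<lambda>k. c k * d k) x"
  using assms by (simp add: stretch_def[of h] stretch_def[of g l] ip_stretch mult.assoc)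

lemma stretch_one: "orthonormal n g \<Longrightarrow> stretch g g (\<lambda>_. 1) x = x"
  by (simp add: stretch_def orthonormal_expansion)

lemma opdet_diagonal: "opdet (stretch onb onb d) = of_real (\<Prod>k<n. d k)"
proof -
  have "ip (stretch onb onb d (onb j)) (onb i) = (if i = j then of_real (d j) else 0)"
    if "i < n" "j < n" for i j
    using that by (simp add: ip_stretch[OF orthonormal_onb] ip_onb)
  then have "Matrix.mat n n (\<lambda>(i, j). ip (stretch onb onb d (onb j)) (onb i))
      = mat_diag n (\<lambda>k. of_real (d k))"
    unfolding mat_diag_def by (intro eq_matI) simp_all
  moreover have "Determinant.det (mat_diag n (\<lambda>k. of_real (d k) :: 'f)) = (\<Prod>k<n. of_real (d k))"
    by (subst det_upper_triangular[of _ n])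
      (auto simp: prod_list_diag_prod mat_diag_def atLeast0LessThan)
  ultimately show ?thesis by (simp add: opdet_def)
qed

text \<open>The two operators are inverse to each other, and their matrices are conjugate transposes.\<close>

lemma norm_opdet_unitary:
  assumes g: "orthonormal n g"
  shows "norm (opdet (stretch g onb (\<lambda>_. 1))) = 1" "norm (opdet (stretch onb g (\<lambda>_. 1))) = 1"
proof -
  let ?U = "stretch g onb (\<lambda>_. 1)" and ?V = "stretch onb g (\<lambda>_. 1)"
  let ?A = "Matrix.mat n n (\<lambda>(i, j). ip (?U (onb j)) (onb i))"
  have V: "?V (onb j) = g j" if "j < n" for j
  proof -
    have "?V (onb j) = (\<Sum>k<n. if k = j then g j else 0)"
      unfolding stretch_def by (rule sum.cong) (use that in \<open>auto simp: ip_onb\<close>)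
    then show ?thesis using that by simp
  qed
  have "Matrix.mat n n (\<lambda>(i, j). ip (?V (onb j)) (onb i)) = transpose_mat (map_mat conjg ?A)"
    by (intro eq_matI)
      (auto simp: V ip_stretch[OF orthonormal_onb] intro: ip_commute)
  then have "opdet ?V = Determinant.det (map_mat conjg ?A)"
    unfolding opdet_def by (simp add: det_transpose[of _ n])
  also have "\<dots> = conjg (opdet ?U)"
    unfolding opdet_def by (rule comm_ring_hom.hom_det[OF comm_ring_hom_conjg])
  finally have conj: "opdet ?V = conjg (opdet ?U)" .
  have "opdet ?U * opdet ?V = opdet (\<lambda>x. ?U (?V x))"
    by (rule opdet_comp[OF lin_stretch, symmetric])
  also have "\<dots> = 1"
    by (simp add: stretch_stretch[OF g] stretch_one[OF orthonormal_onb] opdet_id)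
  finally have "(of_real ((norm (opdet ?U))\<^sup>2) :: 'f) = of_real 1"
    unfolding conj mult_conjg by simp
  then have "(norm (opdet ?U))\<^sup>2 = 1" using of_real_eq_iff by blast
  then show "norm (opdet ?U) = 1" by (metis norm_ge_zero one_power2 power2_eq_imp_eq zero_le_one)
  then show "norm (opdet ?V) = 1" by (simp add: conj)
qed

lemma norm_opdet_stretch:
  assumes g: "orthonormal n g" and h: "orthonormal n h"
  shows "norm (opdet (stretch g h d)) = (\<Prod>k<n. \<bar>d k\<bar>)"
proof -
  have "stretch g h d = (\<lambda>x. stretch onb h (\<lambda>_. 1) (stretch onb onb d (stretch g onb (\<lambda>_. 1) x)))"
    by (simp add: stretch_stretch[OF orthonormal_onb])
  then have "opdet (stretch g h d)
      = opdet (stretch onb h (\<lambda>_. 1)) * (opdet (stretch onb onb d) * opdet (stretch g onb (\<lambda>_. 1)))"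
    using opdet_comp[OF lin_stretch, of onb h "\<lambda>_. 1" "\<lambda>x. stretch onb onb d (stretch g onb (\<lambda>_. 1) x)"]
      opdet_comp[OF lin_stretch, of onb onb d "stretch g onb (\<lambda>_. 1)"]
    by simp
  then show ?thesis
    by (simp add: norm_mult norm_opdet_unitary g h opdet_diagonal flip: prod_norm)
qed

text \<open>A kernel vector \<open>v\<close> can be projected away without changing \<open>T\<close>, and a projection has
  determinant \<open>0\<close>.\<close>

lemma opdet_nonzero_kernel:
  assumes T: "lin T" and det: "opdet T \<noteq> 0" and v: "T v = 0"
  shows "v = 0"
proof (rule ccontr)
  assume "v \<noteq> 0"
  define w where "w = (1 / norm v) *\<^sub>R v"
  have "norm w = 1" using \<open>v \<noteq> 0\<close> by (simp add: w_def)
  then obtain g where g: "orthonormal n g" "g 0 = w" and n: "0 < n"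
    by (rule unit_vector_extend)
  let ?d = "\<lambda>k. if k = (0::nat) then 0 else 1 :: real"
  have "T w = 0" using T v by (simp add: w_def lin_scaleR)
  have "T (stretch g g ?d x) = T x" for x
  proof -
    have "T (stretch g g ?d x) = (\<Sum>k<n. smul (of_real (?d k) * ip x (g k)) (T (g k)))"
      by (simp add: stretch_def lin_sum[OF T] lin_smul[OF T])
    also have "\<dots> = (\<Sum>k<n. smul (ip x (g k)) (T (g k)))"
      using g \<open>T w = 0\<close> by (intro sum.cong) auto
    finally show ?thesis by (simp add: lin_expansion[OF T g(1)])
  qed
  then have "opdet T = opdet T * opdet (stretch g g ?d)"
    using opdet_comp[OF T, of "stretch g g ?d"] by simp
  moreover have "norm (opdet (stretch g g ?d)) = 0"
    unfolding norm_opdet_stretch[OF g(1) g(1)] using n by (auto intro!: prod_zero)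
  ultimately show False using det by simp
qed

text \<open>Following \<open>T\<close> by the unitary operator that takes \<open>g\<close> to \<open>h\<close>. For \<open>h = g\<close> this says that the trace can be
  computed in any orthonormal basis.\<close>

lemma optr_rotate:
  assumes T: "lin T" and g: "orthonormal n g" and h: "orthonormal n h"
  shows "optr (\<lambda>x. stretch g h (\<lambda>_. 1) (T x)) = (\<Sum>k<n. ip (T (h k)) (g k))"
proof -
  have "optr (\<lambda>x. stretch g h (\<lambda>_. 1) (T x))
      = (\<Sum>i<n. \<Sum>k<n. ip (h k) (onb i) * ip (T (onb i)) (g k))"
    by (simp add: optr_def stretch_def ip_sum_left ip_scale_left mult.commute)
  also have "\<dots> = (\<Sum>k<n. \<Sum>i<n. ip (h k) (onb i) * ip (T (onb i)) (g k))"
    by (rule sum.swap)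
  finally show ?thesis by (simp add: ip_lin_expansion[OF T orthonormal_onb])
qed

section \<open>An extremal operator below a given function\<close>

definition below :: "('v \<Rightarrow> real) \<Rightarrow> ('v \<Rightarrow> 'v) \<Rightarrow> bool"
  where "below q T \<longleftrightarrow> lin T \<and> (\<forall>u. norm (T u) \<le> q u)"

text \<open>Unitary factors on the left leave both \<open>norm (A u)\<close> and \<open>|det A|\<close> as they are; the condition on the
  trace selects the positive operator among the candidates that differ by such a factor.\<close>

definition extremal :: "('v \<Rightarrow> real) \<Rightarrow> ('v \<Rightarrow> 'v) \<Rightarrow> bool"
  where "extremal q A \<longleftrightarrow> below q A \<and> (\<forall>T. below q T \<longrightarrow> norm (opdet T) \<le> norm (opdet A)
    \<and> (norm (opdet T) = norm (opdet A) \<longrightarrow> re (optr T) \<le> re (optr A)))"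

text \<open>In matrix entries, the operators below \<open>q\<close> form a compact set, on which \<open>|det|\<close> and then the trace
  attain their maxima. Finitely many values of \<open>q\<close> bound the entries; each condition
  \<open>norm (T u) \<le> q u\<close> is closed whatever \<open>q\<close> is.\<close>

lemma extremal_exists:
  assumes q: "\<And>u. 0 \<le> q u"
  shows "\<exists>A. extremal q A"
proof -
  define op where "op M x = (\<Sum>i<n. smul (\<Sum>j<n. M (i, j) * ip x (onb j)) (onb i))"
    for M :: "nat \<times> nat \<Rightarrow> 'f" and x
  define r where "r = (\<Sum>j<n. q (onb j))"
  define box where "box = {M :: nat \<times> nat \<Rightarrow> 'f. (\<forall>p\<in>{..<n} \<times> {..<n}. norm (M p) \<le> r)
      \<and> (\<forall>p. p \<notin> {..<n} \<times> {..<n} \<longrightarrow> M p = 0)}"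
  define F where "F = box \<inter> {M. \<forall>u. (norm (op M u))\<^sup>2 \<le> (q u)\<^sup>2}"
  have lin_op: "lin (op M)" for M
    by (rule linI)
      (simp_all add: op_def ip_add_left ip_scale_left distrib_left scale_left_distrib
        sum.distrib scale_sum_right sum_distrib_left mult.left_commute)
  have op_entry: "ip (op M (onb j)) (onb i) = M (i, j)" if "i < n" "j < n" for M i j
  proof -
    have "ip (op M (onb j)) (onb i) = (\<Sum>k<n. M (i, k) * ip (onb j) (onb k))"
      unfolding op_def by (rule ip_combination_orthonormal[OF orthonormal_onb that(1)])
    also have "\<dots> = (\<Sum>k<n. if k = j then M (i, j) else 0)"
      by (rule sum.cong) (use that in \<open>auto simp: ip_onb\<close>)
    finally show ?thesis using that by simp
  qed
  have coord: "continuous_on S (\<lambda>M. M p)" for S and p :: "nat \<times> nat"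
    by (rule continuous_on_subset[OF continuous_on_product_coordinates]) auto
  have norm_op: "(norm (op M u))\<^sup>2 = (\<Sum>i<n. (norm (\<Sum>j<n. M (i, j) * ip u (onb j)))\<^sup>2)" for M u
    unfolding op_def by (rule norm_combination_orthonormal[OF orthonormal_onb])
  have "compact box"
    unfolding box_def by (rule compact_box)
  moreover have "closed {M. \<forall>u. (norm (op M u))\<^sup>2 \<le> (q u)\<^sup>2}"
    unfolding norm_op
    by (intro closed_Collect_all closed_Collect_le continuous_intros coord)
  ultimately have "compact F"
    unfolding F_def by (rule compact_Int_closed)
  have below_op: "below q (op M)" if "M \<in> F" for M
    using that q lin_op by (auto simp: F_def below_def intro: power2_le_imp_le)
  have surj: "\<exists>M\<in>F. op M = T" if "below q T" for T
  proof
    have T: "lin T" "\<And>u. norm (T u) \<le> q u" using that by (auto simp: below_def)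
    define M where "M = (\<lambda>(i, j). if i < n \<and> j < n then ip (T (onb j)) (onb i) else 0)"
    show "op M = T"
    proof
      fix x
      have "op M x = (\<Sum>i<n. smul (\<Sum>j<n. ip x (onb j) * ip (T (onb j)) (onb i)) (onb i))"
        unfolding op_def by (intro sum.cong refl arg_cong2[where f=smul]) (simp add: M_def mult.commute)
      then show "op M x = T x"
        by (simp add: ip_lin_expansion[OF T(1) orthonormal_onb] orthonormal_expansion[OF orthonormal_onb])
    qed
    have "norm (ip (T (onb j)) (onb i)) \<le> r" if "i < n" "j < n" for i j
    proof -
      have "norm (ip (T (onb j)) (onb i)) \<le> norm (T (onb j))"
        using cauchy_schwarz[of "T (onb j)" "onb i"] norm_onb[OF that(1)] by simp
      also have "\<dots> \<le> q (onb j)" by (rule T(2))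
      also have "\<dots> \<le> r" unfolding r_def using that q by (intro member_le_sum) auto
      finally show ?thesis .
    qed
    then have "M \<in> box" by (auto simp: box_def M_def)
    then show "M \<in> F" using T(2) by (simp add: F_def \<open>op M = T\<close> power_mono)
  qed
  have det: "opdet (op M) = (\<Sum>p\<in>{p. p permutes {0..<n}}. signof p * (\<Prod>i=0..<n. M (i, p i)))" for M
  proof -
    have "Matrix.mat n n (\<lambda>(i, j). ip (op M (onb j)) (onb i)) = Matrix.mat n n M"
      by (rule eq_matI) (simp_all add: op_entry)
    then have "opdet (op M) = (\<Sum>p\<in>{p. p permutes {0..<n}}.
        signof p * (\<Prod>i=0..<n. Matrix.mat n n M $$ (i, p i)))"
      unfolding opdet_def by (simp only: det_def'[of _ n] mat_carrier)
    also have "\<dots> = (\<Sum>p\<in>{p. p permutes {0..<n}}. signof p * (\<Prod>i=0..<n. M (i, p i)))"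
    proof (intro sum.cong refl arg_cong2[where f="(*)"] prod.cong)
      fix p i assume "p \<in> {p. p permutes {0..<n}}" "i \<in> {0..<n}"
      then have "i < n" "p i < n" using permutes_in_image[of p "{0..<n}" i] by auto
      then show "Matrix.mat n n M $$ (i, p i) = M (i, p i)" by simp
    qed
    finally show ?thesis .
  qed
  have cont_det: "continuous_on S (\<lambda>M. norm (opdet (op M)))" for S
    unfolding det by (intro continuous_intros coord)
  have tr: "optr (op M) = (\<Sum>i<n. M (i, i))" for M
    by (simp add: optr_def op_entry)
  have cont_tr: "continuous_on S (\<lambda>M. re (optr (op M)))" for S
    unfolding tr re_def by (intro continuous_intros coord) auto
  have "below q (\<lambda>_. 0)"
    unfolding below_def by (intro conjI linI) (use q in simp_all)
  then have "F \<noteq> {}" using surj by blast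
  then obtain M1 where M1: "M1 \<in> F" "\<And>M. M \<in> F \<Longrightarrow> norm (opdet (op M)) \<le> norm (opdet (op M1))"
    using continuous_attains_sup[OF \<open>compact F\<close> \<open>F \<noteq> {}\<close> cont_det] by metis
  define G where "G = F \<inter> {M. norm (opdet (op M1)) \<le> norm (opdet (op M))}"
  have "compact G"
    unfolding G_def
    by (intro compact_Int_closed \<open>compact F\<close> closed_Collect_le cont_det continuous_on_const)
  have "G \<noteq> {}" using M1 by (auto simp: G_def)
  obtain M2 where M2: "M2 \<in> G" "\<And>M. M \<in> G \<Longrightarrow> re (optr (op M)) \<le> re (optr (op M2))"
    using continuous_attains_sup[OF \<open>compact G\<close> \<open>G \<noteq> {}\<close> cont_tr] by metis
  have "norm (opdet (op M2)) = norm (opdet (op M1))"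
    using M1(2)[of M2] M2(1) by (simp add: G_def)
  then have "extremal q (op M2)"
    unfolding extremal_def
  proof (intro conjI allI impI)
    show "below q (op M2)" using M2(1) below_op by (simp add: G_def)
    fix T assume eq: "norm (opdet (op M2)) = norm (opdet (op M1))" and "below q T"
    then obtain M where "M \<in> F" "op M = T" using surj by blast
    then show "norm (opdet T) \<le> norm (opdet (op M2))" using M1(2) eq by auto
    assume "norm (opdet T) = norm (opdet (op M2))"
    then show "re (optr T) \<le> re (optr (op M2))"
      using M2(2)[of M] \<open>M \<in> F\<close> \<open>op M = T\<close> eq by (simp add: G_def)
  qed
  then show ?thesis by blast
qed

section \<open>Extremal operators are positive\<close>

lemma extremal_lin: "extremal q A \<Longrightarrow> lin A"
  and extremal_le: "extremal q A \<Longrightarrow> norm (A u) \<le> q u"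
  by (simp_all add: extremal_def below_def)

text \<open>Turning \<open>A\<close> by a unitary operator keeps \<open>norm (A u)\<close> and \<open>|det A|\<close>, hence cannot increase the real part of
  the trace. The next lemmas test this with unitary operators that change one or two basis vectors.\<close>

lemma extremal_rotation:
  assumes A: "extremal q A" and g: "orthonormal n g" and h: "orthonormal n h"
  shows "(\<Sum>k<n. re (ip (A (h k)) (g k))) \<le> (\<Sum>k<n. re (ip (A (g k)) (g k)))"
proof -
  note lin = extremal_lin[OF A]
  let ?T = "\<lambda>x. stretch g h (\<lambda>_. 1) (A x)"
  have "norm (?T u) = norm (A u)" for u
  proof -
    have "(norm (?T u))\<^sup>2 = (norm (A u))\<^sup>2"
      by (simp add: norm_stretch[OF h] parseval[OF g])
    then show ?thesis by simp
  qed
  then have "below q ?T"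
    using extremal_le[OF A] by (simp add: below_def lin_comp[OF lin_stretch lin])
  moreover have "norm (opdet ?T) = norm (opdet A)"
    unfolding opdet_comp[OF lin_stretch, of g h _ A] norm_mult norm_opdet_stretch[OF g h] by simp
  ultimately have "re (optr ?T) \<le> re (optr A)"
    using A by (simp add: extremal_def)
  moreover have "optr A = (\<Sum>k<n. ip (A (g k)) (g k))"
    using optr_rotate[OF lin g g] by (simp add: stretch_one[OF g])
  ultimately show ?thesis
    by (simp add: optr_rotate[OF lin g h] re_sum)
qed

text \<open>Rotate \<open>v\<close> alone, by the phase that makes \<open>\<langle>A v, v\<rangle>\<close> equal to its modulus.\<close>

lemma extremal_unit_nonneg:
  assumes A: "extremal q A" and v: "norm v = 1"
  shows "ip (A v) v = of_real (norm (ip (A v) v))"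
proof (rule norm_le_re_imp_real)
  note lin = extremal_lin[OF A]
  obtain c where c: "norm c = 1" "c * ip (A v) v = of_real (norm (ip (A v) v))"
    using unit_phase by blast
  obtain g where g: "orthonormal n g" "g 0 = v" and n: "0 < n"
    using v by (rule unit_vector_extend)
  define h where "h = g(0 := smul c v)"
  have "ip (smul c v) (smul c v) = 1"
    using v c(1) by (intro ip_unit_self) (simp add: norm_smul)
  then have "orthonormal n h"
    using g by (auto simp: h_def orthonormal_def ip_scale_left ip_scale_right mult.commute)
  from extremal_rotation[OF A g(1) this]
  have "re (ip (A (h 0)) (g 0)) \<le> re (ip (A (g 0)) (g 0))"
    using n by (simp add: sum.remove[of "{..<n}" 0] h_def)
  then show "norm (ip (A v) v) \<le> re (ip (A v) v)"
    using g(2) c(2) by (simp add: h_def lin_smul[OF lin] ip_scale_left)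
qed

lemma extremal_nonneg:
  assumes A: "extremal q A"
  shows "ip (A v) v = of_real (re (ip (A v) v))" "0 \<le> re (ip (A v) v)"
proof -
  note lin = extremal_lin[OF A]
  have "\<exists>r\<ge>0. ip (A v) v = of_real r"
  proof (cases "v = 0")
    case True
    then show ?thesis by (intro exI[of _ 0]) simp
  next
    case False
    define e where "e = (1 / norm v) *\<^sub>R v"
    have v: "v = norm v *\<^sub>R e" using False by (simp add: e_def)
    have "norm e = 1" using False by (simp add: e_def)
    have "ip (A v) v = ip (A (norm v *\<^sub>R e)) (norm v *\<^sub>R e)" using v by simp
    also have "\<dots> = of_real (norm v * norm v) * ip (A e) e"
      by (simp add: lin_scaleR[OF lin] ip_scaleR_left ip_scaleR_right)
    also have "\<dots> = of_real (norm v * norm v * norm (ip (A e) e))"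
      by (subst extremal_unit_nonneg[OF A \<open>norm e = 1\<close>]) simp
    finally show ?thesis by (intro exI[of _ "norm v * norm v * norm (ip (A e) e)"]) simp
  qed
  then show "ip (A v) v = of_real (re (ip (A v) v))" "0 \<le> re (ip (A v) v)" by auto
qed

text \<open>Rotate the plane of \<open>v\<close> and \<open>w\<close>. With \<open>a\<close> and \<open>b\<close> the cosine and sine of the angle, the trace over the
  plane becomes \<open>a C + b S\<close>, where \<open>S\<close> is the defect of symmetry. If \<open>a C + b S \<le> C\<close> for all angles, then
  the choice of \<open>(a, b)\<close> proportional to \<open>(C, S)\<close> forces \<open>S = 0\<close>. For real scalars, where \<open>\<langle>A v, v\<rangle>\<close>
  carries no information on symmetry, this step is indispensable.\<close>

lemma extremal_re_symmetric:
  assumes A: "extremal q A" and vw: "norm v = 1" "norm w = 1" "ip v w = 0"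
  shows "re (ip (A w) v) = re (ip (A v) w)"
proof -
  note lin = extremal_lin[OF A]
  have wv: "ip w v = 0" using vw(3) ip_commute[of w v] by simp
  have "orthonormal 2 (\<lambda>i. if i = 0 then v else w)"
    using vw wv by (auto simp: orthonormal_def ip_unit_self less_2_cases_iff)
  then obtain g where g: "orthonormal n g" "g 0 = v" "g 1 = w" and n: "2 \<le> n"
    using orthonormal_extend[of 2 "\<lambda>i. if i = 0 then v else w"] orthonormal_length_le[of 2] by fastforce
  have g1: "g (Suc 0) = w" using g(3) by simp
  define C where "C = re (ip (A v) v) + re (ip (A w) w)"
  define S where "S = re (ip (A w) v) - re (ip (A v) w)"
  have rot: "a * C + b * S \<le> C" if ab: "a\<^sup>2 + b\<^sup>2 = 1" for a b
  proof -
    define h where "h = g(0 := a *\<^sub>R v + b *\<^sub>R w, 1 := a *\<^sub>R w - b *\<^sub>R v)"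
    have ab': "(of_real a * of_real a + of_real b * of_real b :: 'f) = 1"
      using ab by (metis of_real_1 of_real_add of_real_mult power2_eq_square)
    note ips = ip_add_left ip_add_right ip_diff_left ip_diff_right ip_scaleR_left ip_scaleR_right
    have perp: "ip v (g j) = 0" "ip w (g j) = 0" "ip (g j) v = 0" "ip (g j) w = 0"
      if "j < n" "j \<noteq> 0" "j \<noteq> 1" for j
      using that n orthonormalD[OF g(1), of 0 j] orthonormalD[OF g(1), of 1 j]
        orthonormalD[OF g(1), of j 0] orthonormalD[OF g(1), of j 1] by (auto simp: g g1)
    have "orthonormal n h"
      unfolding orthonormal_def
    proof (intro allI impI)
      fix i j assume "i < n" "j < n"
      then show "ip (h i) (h j) = (if i = j then 1 else 0)"
        using perp[of i] perp[of j] orthonormalD[OF g(1), of i j] ab'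
        by (auto simp: h_def ips ip_unit_self vw wv algebra_simps)
    qed
    from extremal_rotation[OF A g(1) this]
    have "re (ip (A (h 0)) (g 0)) + re (ip (A (h 1)) (g 1))
        \<le> re (ip (A (g 0)) (g 0)) + re (ip (A (g 1)) (g 1))"
      using n by (simp add: sum.remove[of "{..<n}" 0] sum.remove[of "{..<n} - {0}" 1] h_def)
    then show ?thesis
      by (simp add: h_def g g1 lin_add[OF lin] lin_diff[OF lin] lin_scaleR[OF lin]
          ips re_add re_diff re_of_real_mult C_def S_def algebra_simps)
  qed
  have "S = 0"
  proof (rule ccontr)
    assume "S \<noteq> 0"
    define \<rho> where "\<rho> = sqrt (C\<^sup>2 + S\<^sup>2)"
    have \<rho>: "\<rho>\<^sup>2 = C\<^sup>2 + S\<^sup>2" "\<rho> > 0"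
      using \<open>S \<noteq> 0\<close> by (auto simp: \<rho>_def add_nonneg_pos)
    have "(C / \<rho>)\<^sup>2 + (S / \<rho>)\<^sup>2 = 1"
      using \<rho>(2) by (simp add: power_divide add_divide_distrib[symmetric] flip: \<rho>(1))
    from rot[OF this] have "\<rho>\<^sup>2 \<le> C * \<rho>"
      using \<rho> by (simp add: field_simps power2_eq_square)
    then have "\<rho> \<le> C" using \<rho>(2) by (simp add: power2_eq_square)
    then have "\<rho>\<^sup>2 \<le> C\<^sup>2" using \<rho>(2) by (intro power_mono) auto
    then show False using \<rho>(1) \<open>S \<noteq> 0\<close> by simp
  qed
  then show ?thesis by (simp add: S_def)
qed

text \<open>Replacing one of the two vectors by its multiples with phases upgrades symmetry of the real parts
  to symmetry.\<close>

lemma extremal_self_adjoint: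
  assumes A: "extremal q A"
  shows "ip (A u) v = ip u (A v)"
proof -
  note lin = extremal_lin[OF A]
  have basis: "ip (A (onb i)) (onb j) = ip (onb i) (A (onb j))" if ij: "i < n" "j < n" for i j
  proof (cases "i = j")
    case True
    have "ip (onb i) (A (onb i)) = conjg (ip (A (onb i)) (onb i))" by (rule ip_commute)
    then show ?thesis
      using extremal_nonneg(1)[OF A, of "onb i"] True by (metis conjg_of_real)
  next
    case False
    show ?thesis
    proof (rule eq_if_re_phases_eq)
      fix c :: 'f assume c: "norm c = 1"
      have "re (c * ip (A (onb i)) (onb j)) = re (ip (A (smul c (onb i))) (onb j))"
        by (simp add: lin_smul[OF lin] ip_scale_left)
      also have "\<dots> = re (ip (A (onb j)) (smul c (onb i)))"
        by (rule extremal_re_symmetric[OF A, symmetric])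
          (use c ij False in \<open>simp_all add: norm_onb norm_smul ip_scale_left ip_onb\<close>)
      also have "\<dots> = re (conjg (ip (smul c (onb i)) (A (onb j))))"
        by (subst ip_commute) (rule refl)
      finally show "re (c * ip (A (onb i)) (onb j)) = re (c * ip (onb i) (A (onb j)))"
        by (simp add: re_conjg ip_scale_left)
    qed
  qed
  have half: "ip (A x) (onb j) = ip x (A (onb j))" if "j < n" for x j
  proof -
    have "ip (A x) (onb j) = (\<Sum>i<n. ip x (onb i) * ip (A (onb i)) (onb j))"
      by (rule ip_lin_expansion[OF lin orthonormal_onb, symmetric])
    also have "\<dots> = (\<Sum>i<n. ip x (onb i) * ip (onb i) (A (onb j)))"
      using that by (simp add: basis)
    finally show ?thesis by (simp add: ip_expansion[OF orthonormal_onb])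
  qed
  have half': "ip (onb j) (A u) = ip (A (onb j)) u" if "j < n" for j
    using half[OF that, of u] ip_commute[of "onb j" "A u"] ip_commute[of "A (onb j)" u] by simp
  have "ip v (A u) = (\<Sum>j<n. ip v (onb j) * ip (onb j) (A u))"
    by (rule ip_expansion[OF orthonormal_onb, symmetric])
  also have "\<dots> = (\<Sum>j<n. ip v (onb j) * ip (A (onb j)) u)"
    by (simp add: half')
  also have "\<dots> = ip (A v) u" by (rule ip_lin_expansion[OF lin orthonormal_onb])
  finally show ?thesis using ip_commute[of "A u" v] ip_commute[of u "A v"] by simp
qed

text \<open>If \<open>\<langle>A v, v\<rangle> = 0\<close>, then \<open>\<langle>A (v - t A v), v - t A v\<rangle> = t\<^sup>2 R - 2 t |A v|\<^sup>2\<close>, which is negative for small \<open>t > 0\<close>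
  unless \<open>A v = 0\<close>.\<close>

lemma extremal_positive:
  assumes A: "extremal q A" and det: "opdet A \<noteq> 0" and v: "v \<noteq> 0"
  shows "0 < re (ip (A v) v)"
proof (rule ccontr)
  note lin = extremal_lin[OF A]
  assume "\<not> ?thesis"
  then have 0: "re (ip (A v) v) = 0" using extremal_nonneg(2)[OF A, of v] by simp
  define s where "s = (norm (A v))\<^sup>2"
  define R where "R = re (ip (A (A v)) (A v))"
  have s: "s > 0" using opdet_nonzero_kernel[OF lin det, of v] v by (auto simp: s_def)
  have R: "R \<ge> 0" unfolding R_def by (rule extremal_nonneg(2)[OF A])
  have pos: "0 \<le> t\<^sup>2 * R - 2 * t * s" for t
  proof -
    have "ip (A (A v)) v = of_real s"
      using extremal_self_adjoint[OF A, of "A v" v] by (simp add: ip_self s_def)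
    moreover have "ip (A v) (A v) = of_real s" by (simp add: ip_self s_def)
    ultimately have "re (ip (A (v - t *\<^sub>R A v)) (v - t *\<^sub>R A v)) = t\<^sup>2 * R - 2 * t * s"
      unfolding lin_diff[OF lin] lin_scaleR[OF lin] ip_diff_left ip_diff_right
        ip_scaleR_left ip_scaleR_right re_diff re_of_real_mult
      using 0 by (simp add: R_def power2_eq_square right_diff_distrib)
    then show ?thesis using extremal_nonneg(2)[OF A, of "v - t *\<^sub>R A v"] by simp
  qed
  define t where "t = s / (R + 1)"
  have t: "t > 0" "t * (R + 1) = s" using s R by (simp_all add: t_def)
  have "t * (t * R - 2 * s) \<ge> 0" using pos[of t] by (simp add: power2_eq_square algebra_simps)
  then have "t * R - 2 * s \<ge> 0" using t(1) by (simp add: zero_le_mult_iff)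
  then show False using t s by (simp add: algebra_simps)
qed

section \<open>Functionals dominated by the given function\<close>

text \<open>John's variation. Let \<open>\<langle>u, w\<rangle> = \<langle>A u, y\<rangle>\<close> with \<open>r = |y|\<close> and \<open>y = r e\<close>. Every convex combination
  \<open>(1 - \<theta>) |A u|\<^sup>2 + \<theta> |\<langle>u, w\<rangle>|\<^sup>2\<close> is at most \<open>(q u)\<^sup>2\<close>, and it is the squared norm of \<open>A u\<close> after
  stretching \<open>e\<close> by \<open>sqrt (1 - \<theta> + \<theta> r\<^sup>2)\<close> and \<open>e\<^sup>\<bottom>\<close> by \<open>sqrt (1 - \<theta>)\<close>. Hence
  \<open>(1 - \<theta> + \<theta> r\<^sup>2) (1 - \<theta>)\<^sup>n\<^sup>-\<^sup>1 \<le> 1\<close>. The derivative of the left side at \<open>\<theta> = 0\<close> is \<open>r\<^sup>2 - n\<close>, so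
  \<open>r\<^sup>2 \<le> n\<close>, and Cauchy-Schwarz concludes.\<close>

lemma extremal_functional_bound:
  assumes A: "extremal q A" and det: "opdet A \<noteq> 0" and w: "\<And>u. norm (ip u w) \<le> q u"
  shows "norm (ip x w) \<le> sqrt n * norm (A x)"
proof -
  note lin = extremal_lin[OF A]
  have "inj A"
  proof (rule injI)
    fix x y assume "A x = A y"
    then show "x = y"
      using opdet_nonzero_kernel[OF lin det, of "x - y"] by (simp add: lin_diff[OF lin])
  qed
  then have "surj A" using linear_inj_imp_surj lin by blast
  then obtain y where y: "A y = w" by (metis surjD)
  have ipw: "ip u w = ip (A u) y" for u
    using extremal_self_adjoint[OF A, of u y] by (simp add: y)
  define r where "r = norm y"
  have "r \<le> sqrt n"
  proof (rule ccontr)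
    assume "\<not> r \<le> sqrt n"
    then have r: "r > sqrt n" by simp
    then have "r > 0" using real_sqrt_ge_zero[of n] by linarith
    have rn: "r\<^sup>2 > n" using power_strict_mono[OF r, of 2] by simp
    define e where "e = (1 / r) *\<^sub>R y"
    have ye: "y = r *\<^sub>R e" using \<open>r > 0\<close> by (simp add: e_def)
    have "norm e = 1" using \<open>r > 0\<close> by (simp add: e_def r_def)
    then obtain g where g: "orthonormal n g" "g 0 = e" and n: "0 < n"
      by (rule unit_vector_extend)
    \<comment> \<open>Small enough for the linear term \<open>\<theta> (r\<^sup>2 - n)\<close> to dominate the quadratic one
      \<open>\<theta>\<^sup>2 (r\<^sup>2 - 1) (n - 1)\<close> left by Bernoulli's inequality.\<close>
    define \<theta> where "\<theta> = (r\<^sup>2 - n) / (r\<^sup>2 * n)"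
    have \<theta>: "0 < \<theta>" "\<theta> < 1"
    proof -
      show "0 < \<theta>" using rn n \<open>r > 0\<close> by (simp add: \<theta>_def)
      have "r\<^sup>2 - n < r\<^sup>2 * 1" using n by simp
      also have "\<dots> \<le> r\<^sup>2 * n" using n by (intro mult_left_mono) auto
      finally show "\<theta> < 1" using rn n by (simp add: \<theta>_def)
    qed
    define d where "d k = (if k = 0 then sqrt (1 - \<theta> + \<theta> * r\<^sup>2) else sqrt (1 - \<theta>))" for k :: nat
    have d2: "(d k)\<^sup>2 = (1 - \<theta>) + (if k = 0 then \<theta> * r\<^sup>2 else 0)" for k
      using \<theta> by (simp add: d_def)
    let ?T = "\<lambda>x. stretch g g d (A x)"
    have "below q ?T"
      unfolding below_def
    proof (intro conjI allI)
      show "lin ?T" by (rule lin_comp[OF lin_stretch lin])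
      fix u
      have "(norm (?T u))\<^sup>2 = (\<Sum>k<n. (1 - \<theta>) * (norm (ip (A u) (g k)))\<^sup>2
          + (if k = 0 then \<theta> * r\<^sup>2 * (norm (ip (A u) (g k)))\<^sup>2 else 0))"
        unfolding norm_stretch[OF g(1)] d2 by (intro sum.cong refl) (simp add: algebra_simps)
      also have "\<dots> = (1 - \<theta>) * (norm (A u))\<^sup>2 + \<theta> * r\<^sup>2 * (norm (ip (A u) e))\<^sup>2"
        using n by (simp add: sum.distrib sum_distrib_left[symmetric] parseval[OF g(1)] g(2))
      also have "\<theta> * r\<^sup>2 * (norm (ip (A u) e))\<^sup>2 = \<theta> * (norm (ip u w))\<^sup>2"
        unfolding ipw using \<open>r > 0\<close>
        by (subst ye) (simp add: ip_scaleR_right norm_mult power_mult_distrib)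
      also have "(1 - \<theta>) * (norm (A u))\<^sup>2 + \<theta> * (norm (ip u w))\<^sup>2 \<le> (1 - \<theta>) * (q u)\<^sup>2 + \<theta> * (q u)\<^sup>2"
        using \<theta> w extremal_le[OF A] by (intro add_mono mult_left_mono power_mono) auto
      finally have "(norm (?T u))\<^sup>2 \<le> (q u)\<^sup>2" by (simp add: algebra_simps)
      then show "norm (?T u) \<le> q u"
        by (rule power2_le_imp_le) (rule order_trans[OF norm_ge_zero extremal_le[OF A]])
    qed
    then have "norm (opdet ?T) \<le> norm (opdet A)" using A by (simp add: extremal_def)
    then have "(\<Prod>k<n. \<bar>d k\<bar>) * norm (opdet A) \<le> 1 * norm (opdet A)"
      unfolding opdet_comp[OF lin_stretch, of g g d A] norm_mult norm_opdet_stretch[OF g(1) g(1)] by simp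
    then have "(\<Prod>k<n. \<bar>d k\<bar>) \<le> 1" using det by (simp only: mult_le_cancel_right) auto
    then have "(\<Prod>k<n. \<bar>d k\<bar>)\<^sup>2 \<le> 1" by (intro power_le_one prod_nonneg) auto
    also have "(\<Prod>k<n. \<bar>d k\<bar>)\<^sup>2 = (\<Prod>k<n. (d k)\<^sup>2)"
      by (simp add: prod_power_distrib)
    also have "\<dots> = (1 - \<theta> + \<theta> * r\<^sup>2) * (1 - \<theta>) ^ (n - 1)"
    proof -
      have "(\<Prod>k<n. (d k)\<^sup>2) = (d 0)\<^sup>2 * (\<Prod>k\<in>{..<n} - {0}. (d k)\<^sup>2)"
        using n by (intro prod.remove) auto
      also have "(\<Prod>k\<in>{..<n} - {0}. (d k)\<^sup>2) = (\<Prod>k\<in>{..<n} - {0}. 1 - \<theta>)"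
        by (intro prod.cong) (simp_all add: d2)
      finally show ?thesis using n by (simp add: d2)
    qed
    finally have le1: "(1 - \<theta> + \<theta> * r\<^sup>2) * (1 - \<theta>) ^ (n - 1) \<le> 1" .
    have "1 + real (n - 1) * (- \<theta>) \<le> (1 + - \<theta>) ^ (n - 1)"
      using \<theta> by (intro Bernoulli_inequality) auto
    then have "(1 - \<theta> + \<theta> * r\<^sup>2) * (1 - (real n - 1) * \<theta>) \<le> (1 - \<theta> + \<theta> * r\<^sup>2) * (1 - \<theta>) ^ (n - 1)"
      using \<theta> n by (intro mult_left_mono add_nonneg_nonneg) (auto simp: of_nat_diff algebra_simps)
    with le1 have "(1 - \<theta> + \<theta> * r\<^sup>2) * (1 - (real n - 1) * \<theta>) \<le> 1" by linarith
    then have "\<theta> * (r\<^sup>2 - n - \<theta> * ((r\<^sup>2 - 1) * (real n - 1))) \<le> 0"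
      by (simp add: algebra_simps)
    then have "r\<^sup>2 - n \<le> \<theta> * ((r\<^sup>2 - 1) * (real n - 1))"
      using \<theta> by (simp add: mult_le_0_iff)
    also have "\<dots> < \<theta> * (r\<^sup>2 * n)"
    proof -
      have "r\<^sup>2 + n > 1" using rn n by linarith
      then show ?thesis using \<theta> by (intro mult_strict_left_mono) (auto simp: algebra_simps)
    qed
    also have "\<dots> = r\<^sup>2 - n" using n \<open>r > 0\<close> by (simp add: \<theta>_def)
    finally show False by simp
  qed
  then have "norm (A x) * norm y \<le> norm (A x) * sqrt n"
    by (intro mult_left_mono) (simp_all add: r_def)
  then show ?thesis
    using cauchy_schwarz[of "A x" y] by (simp add: ipw mult.commute)
qed

end

section \<open>Convex hulls of quasinorm balls\<close>

text \<open>The functional is \<open>\<langle>_, x - c\<rangle>\<close> for the point \<open>c\<close> of \<open>C\<close> nearest to \<open>x\<close>. The assumption \<open>0 \<in> C\<close> locates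
  \<open>c\<close> in the compact ball of radius \<open>2 |x|\<close>: points outside it are farther from \<open>x\<close> than \<open>0\<close> is.\<close>

lemma (in finite_dim_hilbert_space) separating_functional:
  assumes C: "closed C" "convex C" "0 \<in> C" and x: "x \<notin> C"
  shows "\<exists>w \<beta>. (\<forall>u\<in>C. re (ip u w) \<le> \<beta>) \<and> \<beta> < re (ip x w)"
proof -
  define D where "D = cball 0 (2 * norm x) \<inter> C"
  have "compact D" unfolding D_def by (intro compact_Int_closed compact_cball_space C)
  moreover have "0 \<in> D" using C by (simp add: D_def)
  ultimately obtain c where c: "c \<in> D" "\<And>u. u \<in> D \<Longrightarrow> norm (x - c) \<le> norm (x - u)"
    using continuous_attains_inf[of D "\<lambda>u. norm (x - u)"] by (fastforce intro!: continuous_intros)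
  have nearest: "norm (x - c) \<le> norm (x - u)" if "u \<in> C" for u
  proof (cases "u \<in> D")
    case False
    then have "2 * norm x < norm u" using that by (simp add: D_def)
    then have "norm x \<le> norm (x - u)" using norm_triangle_ineq2[of u x] by (simp add: norm_minus_commute)
    then show ?thesis using c(2)[OF \<open>0 \<in> D\<close>] by simp
  qed (use c in auto)
  define w where "w = x - c"
  have "c \<in> C" using c by (simp add: D_def)
  then have "w \<noteq> 0" using x by (auto simp: w_def)
  have "re (ip u w) \<le> re (ip c w)" if u: "u \<in> C" for u
  proof (rule ccontr)
    define d where "d = u - c"
    define s where "s = re (ip d w)"
    assume "\<not> ?thesis"
    then have s: "s > 0" by (simp add: s_def d_def ip_diff_left re_diff)
    then have "d \<noteq> 0" by (auto simp: s_def)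
    \<comment> \<open>Moving from \<open>c\<close> towards \<open>u\<close> by \<open>t d\<close> does not decrease the distance to \<open>x\<close>.\<close>
    have ineq: "2 * s \<le> t * (norm d)\<^sup>2" if t: "0 < t" "t \<le> 1" for t
    proof -
      have "(1 - t) *\<^sub>R c + t *\<^sub>R u \<in> C"
        using C(2) \<open>c \<in> C\<close> u t by (intro convexD) auto
      from nearest[OF this] have "norm w \<le> norm (w + (- t) *\<^sub>R d)"
        by (simp add: w_def d_def algebra_simps)
      then have "(norm w)\<^sup>2 \<le> (norm (w + (- t) *\<^sub>R d))\<^sup>2" by (intro power_mono) auto
      also have "\<dots> = (norm w)\<^sup>2 + 2 * (- t * s) + t\<^sup>2 * (norm d)\<^sup>2"
        using ip_commute[of d w] re_conjg[of "ip w d"]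
        unfolding norm_add_sq ip_scaleR_right re_of_real_mult by (simp add: s_def power_mult_distrib)
      finally have "t * (2 * s) \<le> t * (t * (norm d)\<^sup>2)" by (simp add: power2_eq_square algebra_simps)
      then show ?thesis using t by simp
    qed
    define t where "t = min 1 (s / (norm d)\<^sup>2)"
    have "0 < t" "t \<le> 1" using s \<open>d \<noteq> 0\<close> by (simp_all add: t_def)
    moreover have "t * (norm d)\<^sup>2 \<le> s / (norm d)\<^sup>2 * (norm d)\<^sup>2"
      by (intro mult_right_mono) (simp_all add: t_def)
    then have "t * (norm d)\<^sup>2 \<le> s" using \<open>d \<noteq> 0\<close> by simp
    ultimately show False using ineq[of t] s by linarith
  qed
  moreover have "re (ip c w) < re (ip x w)"
  proof -
    have "re (ip x w) - re (ip c w) = (norm w)\<^sup>2"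
      by (metis ip_diff_left ip_self re_diff re_of_real w_def)
    then show ?thesis using \<open>w \<noteq> 0\<close> by (metis diff_gt_0_iff_gt zero_less_norm_iff zero_less_power)
  qed
  ultimately show ?thesis by blast
qed

locale finite_dim_quasinorm = finite_dim_hilbert_space smul ip Basis n
  for smul :: "'f::rclike \<Rightarrow> 'v::banach \<Rightarrow> 'v" and ip :: "'v \<Rightarrow> 'v \<Rightarrow> 'f"
    and Basis :: "'v set" and n :: nat +
  fixes q :: "'v \<Rightarrow> real" and K :: real
  assumes quasinorm: "quasinorm smul K q" and lsc: "lower_semicontinuous q"
begin

lemma K_ge_1: "1 \<le> K"
  and q_nonneg: "0 \<le> q u"
  and q_eq_0: "q u = 0 \<longleftrightarrow> u = 0"
  and q_smul: "q (smul c u) = norm c * q u"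
  and q_add: "q (u + v) \<le> K * (q u + q v)"
  using quasinorm by (auto simp: quasinorm_def)

lemma q_scaleR: "q (r *\<^sub>R u) = \<bar>r\<bar> * q u"
  by (simp add: q_smul norm_of_real flip: scale_of_real)

lemma q_sum: "finite S \<Longrightarrow> q (\<Sum>v\<in>S. x v) \<le> K ^ card S * (\<Sum>v\<in>S. q (x v))"
proof (induction S rule: finite_induct)
  case empty
  then show ?case using q_eq_0[of 0] by simp
next
  case (insert a S)
  have "q (\<Sum>v\<in>insert a S. x v) \<le> K * (q (x a) + q (\<Sum>v\<in>S. x v))"
    using insert q_add by simp
  also have "\<dots> \<le> K * (K ^ card S * q (x a) + K ^ card S * (\<Sum>v\<in>S. q (x v)))"
    using insert.IH K_ge_1 q_nonneg[of "x a"] one_le_power[OF K_ge_1, of "card S"]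
      mult_right_mono[of 1 "K ^ card S" "q (x a)"]
    by (intro mult_left_mono add_mono) auto
  finally show ?case using insert by (simp add: algebra_simps)
qed

text \<open>Caratheodory for cones, keeping track of the cost \<open>\<Sum>v\<in>S. u v * q v\<close>. More than \<open>2 n\<close> vectors are
  dependent over the reals, and a dependence \<open>a\<close> with \<open>\<Sum>v\<in>S. a v * q v \<ge> 0\<close> can be subtracted
  until one coefficient vanishes, at no additional cost. Once at most \<open>2 n\<close> vectors are left, the
  quasi-triangle inequality applies. Convex combinations, whose coefficients
  must keep the sum \<open>1\<close>, would need one vector more.\<close>

lemma q_conic_combination:
  assumes "finite S" "\<And>v. v \<in> S \<Longrightarrow> 0 \<le> u v"
  shows "q (\<Sum>v\<in>S. u v *\<^sub>R v) \<le> K ^ (2 * n) * (\<Sum>v\<in>S. u v * q v)"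
  using assms
proof (induction "card S" arbitrary: S u rule: less_induct)
  case less
  show ?case
  proof (cases "card S \<le> 2 * n")
    case True
    have "q (\<Sum>v\<in>S. u v *\<^sub>R v) \<le> K ^ card S * (\<Sum>v\<in>S. u v * q v)"
      using q_sum[OF less.prems(1), of "\<lambda>v. u v *\<^sub>R v"] less.prems(2) by (simp add: q_scaleR)
    also have "\<dots> \<le> K ^ (2 * n) * (\<Sum>v\<in>S. u v * q v)"
      using True K_ge_1 less.prems(2) q_nonneg
      by (intro mult_right_mono power_increasing sum_nonneg mult_nonneg_nonneg) auto
    finally show ?thesis .
  next
    case False
    then have "Real_Vector_Spaces.dependent S"
      using real_independent_card_le[OF less.prems(1)] by blast
    then obtain b v0 where b: "(\<Sum>v\<in>S. b v *\<^sub>R v) = 0" "v0 \<in> S" "b v0 \<noteq> 0"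
      unfolding real_vector.dependent_finite[OF less.prems(1)] by blast
    have "\<exists>a v. (\<Sum>v\<in>S. a v *\<^sub>R v) = 0 \<and> 0 \<le> (\<Sum>v\<in>S. a v * q v) \<and> v \<in> S \<and> 0 < a v"
    proof -
      have ex_pos: "\<exists>v\<in>S. 0 < a v" if "0 < (\<Sum>v\<in>S. a v * q v)" for a
      proof (rule ccontr)
        assume "\<not> ?thesis"
        then have "(\<Sum>v\<in>S. a v * q v) \<le> 0"
          using q_nonneg by (intro sum_nonpos) (auto simp: mult_le_0_iff not_less)
        then show False using that by simp
      qed
      have minus: "(\<Sum>v\<in>S. - b v *\<^sub>R v) = 0" "(\<Sum>v\<in>S. - b v * q v) = - (\<Sum>v\<in>S. b v * q v)"
        using b(1) by (simp_all add: sum_negf)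
      \<comment> \<open>One of \<open>b\<close> and \<open>- b\<close> will do; if the cost of \<open>b\<close> is zero, the sign of \<open>b v0\<close> decides.\<close>
      consider "0 < (\<Sum>v\<in>S. b v * q v)" | "(\<Sum>v\<in>S. b v * q v) < 0"
        | "(\<Sum>v\<in>S. b v * q v) = 0" "0 < b v0" | "(\<Sum>v\<in>S. b v * q v) = 0" "b v0 < 0"
        using b(3) by linarith
      then show ?thesis
      proof cases
        case 1
        then show ?thesis using ex_pos[of b] b(1) by (intro exI[of _ b]) auto
      next
        case 2
        then show ?thesis using ex_pos[of "\<lambda>v. - b v"] minus
          by (intro exI[of _ "\<lambda>v. - b v"]) auto
      next
        case 3
        then show ?thesis using b by (intro exI[of _ b] exI[of _ v0]) auto
      next
        case 4
        then show ?thesis using b minus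
          by (intro exI[of _ "\<lambda>v. - b v"] exI[of _ v0]) auto
      qed
    qed
    then obtain a v1 where a: "(\<Sum>v\<in>S. a v *\<^sub>R v) = 0" "0 \<le> (\<Sum>v\<in>S. a v * q v)"
      and v1: "v1 \<in> S" "0 < a v1" by blast
    \<comment> \<open>\<open>k\<close> is the index whose coefficient vanishes first.\<close>
    have "finite {v \<in> S. 0 < a v}" "{v \<in> S. 0 < a v} \<noteq> {}" using less.prems(1) v1 by auto
    then obtain k where k: "k \<in> S" "0 < a k"
      and min: "\<And>v. v \<in> S \<Longrightarrow> 0 < a v \<Longrightarrow> u k / a k \<le> u v / a v"
      using ex_is_arg_min_if_finite[of "{v \<in> S. 0 < a v}" "\<lambda>v. u v / a v"]
      by (auto simp: is_arg_min_linorder)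
    define t where "t = u k / a k"
    have t: "0 \<le> t" using k less.prems(2) by (simp add: t_def)
    define u' where "u' v = u v - t * a v" for v
    have u'k: "u' k = 0" using k by (simp add: u'_def t_def)
    have u'_nonneg: "0 \<le> u' v" if "v \<in> S" for v
    proof (cases "0 < a v")
      case True
      then show ?thesis using min[OF that True] by (simp add: u'_def t_def field_simps)
    next
      case False
      then have "t * a v \<le> 0" using t by (simp add: mult_le_0_iff)
      then show ?thesis using less.prems(2)[OF that] by (simp add: u'_def)
    qed
    have "(\<Sum>v\<in>S. u' v *\<^sub>R v) = (\<Sum>v\<in>S. u v *\<^sub>R v) - t *\<^sub>R (\<Sum>v\<in>S. a v *\<^sub>R v)"
      by (simp add: u'_def scaleR_left_diff_distrib sum_subtractf scaleR_right.sum)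
    then have "q (\<Sum>v\<in>S. u v *\<^sub>R v) = q (\<Sum>v\<in>S - {k}. u' v *\<^sub>R v)"
      using a(1) k(1) less.prems(1) u'k by (simp add: sum.remove[of S k])
    also have "\<dots> \<le> K ^ (2 * n) * (\<Sum>v\<in>S - {k}. u' v * q v)"
      by (rule less.hyps) (use card_Diff1_less[OF less.prems(1) k(1)] less.prems(1) u'_nonneg in auto)
    also have "(\<Sum>v\<in>S - {k}. u' v * q v) = (\<Sum>v\<in>S. u' v * q v)"
      using k(1) less.prems(1) u'k by (simp add: sum.remove[of S k])
    also have "\<dots> = (\<Sum>v\<in>S. u v * q v) - t * (\<Sum>v\<in>S. a v * q v)"
      by (simp add: u'_def left_diff_distrib sum_subtractf sum_distrib_left mult.assoc)
    also have "K ^ (2 * n) * \<dots> \<le> K ^ (2 * n) * (\<Sum>v\<in>S. u v * q v)"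
      using K_ge_1 t a(2) by (intro mult_left_mono) auto
    finally show ?thesis .
  qed
qed

definition unit_ball :: "'v set"
  where "unit_ball = {u. q u \<le> 1}"

lemma open_q_greater: "open {v. c < q v}"
proof (subst open_subopen, intro ballI)
  fix u assume "u \<in> {v. c < q v}"
  then have "\<forall>\<^sub>F v in nhds u. c < q v" using lsc by (simp add: lower_semicontinuous_def)
  then show "\<exists>T. open T \<and> u \<in> T \<and> T \<subseteq> {v. c < q v}" by (auto simp: eventually_nhds)
qed

lemma q_le_on_closed_hull:
  assumes "x \<in> closure (convex hull unit_ball)"
  shows "q x \<le> K ^ (2 * n)"
proof -
  have "- {v. K ^ (2 * n) < q v} = {v. q v \<le> K ^ (2 * n)}" by auto
  then have "closed {v. q v \<le> K ^ (2 * n)}"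
    using open_q_greater[of "K ^ (2 * n)"] by (metis closed_def double_complement)
  moreover have "convex hull unit_ball \<subseteq> {v. q v \<le> K ^ (2 * n)}"
  proof
    fix y assume "y \<in> convex hull unit_ball"
    then obtain S u where S: "finite S" "S \<subseteq> unit_ball" "\<forall>v\<in>S. 0 \<le> u v" "sum u S = 1"
      and y: "(\<Sum>v\<in>S. u v *\<^sub>R v) = y"
      unfolding convex_hull_explicit by blast
    have "q y \<le> K ^ (2 * n) * (\<Sum>v\<in>S. u v * q v)"
      unfolding y[symmetric] using S by (intro q_conic_combination) auto
    also have "(\<Sum>v\<in>S. u v * q v) \<le> (\<Sum>v\<in>S. u v * 1)"
      using S by (intro sum_mono mult_left_mono) (auto simp: unit_ball_def)
    finally show "y \<in> {v. q v \<le> K ^ (2 * n)}" using S K_ge_1 by simp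
  qed
  ultimately show ?thesis using closure_minimal assms by blast
qed

text \<open>A positive lower semicontinuous function is bounded away from \<open>0\<close> on the compact unit sphere.\<close>

lemma q_lower_bound: "\<exists>\<epsilon>>0. \<forall>u. \<epsilon> * norm u \<le> q u"
proof -
  have "compact (cball 0 1 \<inter> sphere (0::'v) 1)"
    by (intro compact_Int_closed compact_cball_space)
      (auto simp: sphere_def intro!: closed_Collect_eq continuous_intros)
  moreover have "cball 0 1 \<inter> sphere (0::'v) 1 \<subseteq> (\<Union>m. {v. inverse (real (Suc m)) < q v})"
  proof
    fix v :: 'v assume "v \<in> cball 0 1 \<inter> sphere 0 1"
    then have "q v > 0" using q_nonneg[of v] q_eq_0[of v] by fastforce
    then show "v \<in> (\<Union>m. {v. inverse (real (Suc m)) < q v})"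
      using reals_Archimedean by blast
  qed
  ultimately obtain M where M: "finite M"
    "cball 0 1 \<inter> sphere (0::'v) 1 \<subseteq> (\<Union>m\<in>M. {v. inverse (real (Suc m)) < q v})"
    using compactE_image[of _ UNIV "\<lambda>m. {v. inverse (real (Suc m)) < q v}"] open_q_greater
    by metis
  define \<epsilon> where "\<epsilon> = inverse (real (Suc (Max (insert 0 M))))"
  have "\<epsilon> * norm u \<le> q u" for u
  proof (cases "u = 0")
    case False
    define v where "v = (1 / norm u) *\<^sub>R u"
    have v: "norm v = 1" "u = norm u *\<^sub>R v" using False by (simp_all add: v_def)
    have "v \<in> cball 0 1 \<inter> sphere 0 1" using v(1) by simp
    then obtain m where m: "m \<in> M" "inverse (real (Suc m)) < q v"
      using M(2) by blast
    have "m \<le> Max (insert 0 M)" using m M(1) by simp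
    then have "\<epsilon> \<le> inverse (real (Suc m))" unfolding \<epsilon>_def by (intro le_imp_inverse_le) auto
    then have "norm u * \<epsilon> \<le> norm u * q v" using m by (intro mult_left_mono) auto
    also have "\<dots> = q (norm u *\<^sub>R v)" by (simp add: q_scaleR)
    finally show ?thesis using v(2) by (simp add: mult.commute)
  qed (simp add: q_nonneg)
  moreover have "\<epsilon> > 0" by (simp add: \<epsilon>_def)
  ultimately show ?thesis by blast
qed

text \<open>A small multiple of the identity is below \<open>q\<close>.\<close>

lemma extremal_opdet_nonzero:
  assumes "extremal q A"
  shows "opdet A \<noteq> 0"
proof -
  obtain \<epsilon> where \<epsilon>: "\<epsilon> > 0" "\<And>u. \<epsilon> * norm u \<le> q u" using q_lower_bound by blast
  let ?T = "stretch onb onb (\<lambda>_. \<epsilon>)"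
  have "norm (?T u) \<le> q u" for u
  proof -
    have "(norm (?T u))\<^sup>2 = (\<epsilon> * norm u)\<^sup>2"
      by (simp add: norm_stretch[OF orthonormal_onb] power_mult_distrib
          parseval[OF orthonormal_onb] flip: sum_distrib_left)
    then have "norm (?T u) = \<epsilon> * norm u" using \<epsilon>(1) by (simp add: power2_eq_iff_nonneg)
    then show ?thesis using \<epsilon>(2) by simp
  qed
  then have "norm (opdet ?T) \<le> norm (opdet A)"
    using assms by (simp add: extremal_def below_def lin_stretch)
  moreover have "norm (opdet ?T) > 0"
    unfolding norm_opdet_stretch[OF orthonormal_onb orthonormal_onb] using \<epsilon>(1) by simp
  ultimately show ?thesis by auto
qed

text \<open>A separating \<open>w\<close>, scaled so that \<open>\<langle>_, w\<rangle>\<close> has modulus at most \<open>1\<close> on the unit ball, contradicts the bound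
  on dominated functionals. Separation controls only the real part; the modulus follows because
  the unit ball is invariant under phases.\<close>

lemma extremal_ellipsoid_in_hull:
  assumes A: "extremal q A" and x: "sqrt n * norm (A x) \<le> 1"
  shows "x \<in> closure (convex hull unit_ball)"
proof (rule ccontr)
  let ?C = "closure (convex hull unit_ball)"
  have sub: "unit_ball \<subseteq> ?C" using hull_subset closure_subset by (rule order_trans)
  have "0 \<in> unit_ball" using q_eq_0[of 0] by (simp add: unit_ball_def)
  assume "x \<notin> ?C"
  then obtain w \<beta> where w: "\<forall>u\<in>?C. re (ip u w) \<le> \<beta>" "\<beta> < re (ip x w)"
    using separating_functional[of ?C x] sub \<open>0 \<in> unit_ball\<close> by (metis closed_closure convex_closure convex_convex_hull subsetD)
  \<comment> \<open>The multiple of \<open>w\<close> in the unit ball shows that the separating level is positive.\<close>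
  have "w \<noteq> 0"
    using w sub \<open>0 \<in> unit_ball\<close> by fastforce
  then have "q w > 0" using q_nonneg[of w] q_eq_0[of w] by simp
  have "(1 / q w) *\<^sub>R w \<in> unit_ball"
    using \<open>q w > 0\<close> by (simp add: unit_ball_def q_scaleR)
  then have "re (ip ((1 / q w) *\<^sub>R w) w) \<le> \<beta>" using w(1) sub by blast
  moreover have "re (ip ((1 / q w) *\<^sub>R w) w) = (norm w)\<^sup>2 / q w"
    unfolding ip_scaleR_left ip_self re_of_real_mult re_of_real by simp
  moreover have "(norm w)\<^sup>2 / q w > 0" using \<open>w \<noteq> 0\<close> \<open>q w > 0\<close> by simp
  ultimately have "\<beta> > 0" by linarith
  have ball: "norm (ip b w) \<le> \<beta>" if "b \<in> unit_ball" for b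
  proof -
    obtain c where c: "norm c = 1" "c * ip b w = of_real (norm (ip b w))" using unit_phase by blast
    then have "smul c b \<in> unit_ball" using that by (simp add: unit_ball_def q_smul)
    then have "re (ip (smul c b) w) \<le> \<beta>" using w(1) sub by blast
    then show ?thesis by (simp add: ip_scale_left c(2))
  qed
  have dom: "norm (ip u ((1 / \<beta>) *\<^sub>R w)) \<le> q u" for u
  proof (cases "u = 0")
    case False
    then have "q u > 0" using q_nonneg[of u] q_eq_0[of u] by simp
    then have "norm (ip ((1 / q u) *\<^sub>R u) w) \<le> \<beta>"
      by (intro ball) (simp add: unit_ball_def q_scaleR)
    then show ?thesis
      using \<open>q u > 0\<close> \<open>\<beta> > 0\<close>
      by (simp add: ip_scaleR_left ip_scaleR_right norm_mult norm_divide field_simps)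
  qed (simp add: q_nonneg)
  have "1 < re (ip x w) / \<beta>" using w(2) \<open>\<beta> > 0\<close> by simp
  also have "\<dots> = re (ip x ((1 / \<beta>) *\<^sub>R w))"
    unfolding ip_scaleR_right re_of_real_mult by simp
  also have "\<dots> \<le> norm (ip x ((1 / \<beta>) *\<^sub>R w))" by (rule re_le_norm)
  also have "\<dots> \<le> sqrt n * norm (A x)"
    by (rule extremal_functional_bound[OF A extremal_opdet_nonzero[OF A] dom])
  finally show False using x by simp
qed

lemma extremal_upper:
  assumes A: "extremal q A"
  shows "q u \<le> K ^ (2 * n) * (sqrt n * norm (A u))"
proof (cases "u = 0")
  case True
  then show ?thesis using q_eq_0[of u] K_ge_1 by simp
next
  case False
  have "A u \<noteq> 0"
    using opdet_nonzero_kernel[OF extremal_lin[OF A] extremal_opdet_nonzero[OF A]] False by blast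
  have "n > 0" using False by (rule dim_pos)
  define s where "s = sqrt n * norm (A u)"
  have "s > 0" using \<open>A u \<noteq> 0\<close> \<open>n > 0\<close> by (simp add: s_def)
  have "sqrt n * norm (A ((1 / s) *\<^sub>R u)) \<le> 1"
    using \<open>s > 0\<close> by (simp add: lin_scaleR[OF extremal_lin[OF A]]) (simp add: s_def)
  then have "q ((1 / s) *\<^sub>R u) \<le> K ^ (2 * n)"
    by (intro q_le_on_closed_hull extremal_ellipsoid_in_hull[OF A])
  then show ?thesis using \<open>s > 0\<close> by (simp add: q_scaleR field_simps s_def)
qed

end

theorem proposition2p4:
  fixes smul :: "'f::rclike \<Rightarrow> 'v::banach \<Rightarrow> 'v"
    and ip :: "'v \<Rightarrow> 'v \<Rightarrow> 'f"
    and Basis :: "'v set"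
    and n :: nat
    and q :: "'v \<Rightarrow> real"
    and K :: real
  assumes "hilbert_space smul ip"
    and "finite_dimensional_vector_space smul Basis"
    and "vector_space.dim smul (UNIV :: 'v set) = n"
    and "quasinorm smul K q"
    and "lower_semicontinuous q"
  shows "\<exists>A :: 'v \<Rightarrow> 'v.
    Vector_Spaces.linear smul smul A \<and> self_adjoint ip A \<and> positive_definite ip A \<and>
    (\<forall>u. K powi (- 2 * int n) * q u \<le> norm (A u) \<and> norm (A u) \<le> sqrt (real n) * q u)"
proof -
  interpret hilbert_space smul ip by fact
  interpret finite_dimensional_vector_space smul Basis by fact
  interpret finite_dim_quasinorm smul ip Basis n q K
    by unfold_locales (use assms in simp_all)
  obtain A where A: "extremal q A" using extremal_exists q_nonneg by blast
  note lin = extremal_lin[OF A]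
  define B where "B u = sqrt n *\<^sub>R A u" for u
  have "lin B"
  proof (rule linI)
    show "B (smul c x) = smul c (B x)" for c x
      by (simp add: B_def lin_smul[OF lin] mult.commute flip: scale_of_real)
  qed (simp add: B_def lin_add[OF lin] scaleR_add_right)
  moreover have "self_adjoint ip B"
    by (simp add: self_adjoint_def B_def ip_scaleR_left ip_scaleR_right extremal_self_adjoint[OF A])
  moreover have "positive_definite ip B"
    unfolding positive_definite_def
  proof (intro allI impI)
    fix u :: 'v assume "u \<noteq> 0"
    have "n > 0" using \<open>u \<noteq> 0\<close> by (rule dim_pos)
    have "ip (B u) u = of_real (sqrt n * re (ip (A u) u))"
      unfolding B_def ip_scaleR_left of_real_mult extremal_nonneg(1)[OF A, of u, symmetric] ..
    moreover have "sqrt n * re (ip (A u) u) > 0"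
      using extremal_positive[OF A extremal_opdet_nonzero[OF A] \<open>u \<noteq> 0\<close>] \<open>n > 0\<close> by simp
    ultimately show "\<exists>r>0. ip (B u) u = of_real r" by blast
  qed
  moreover have "K powi (- 2 * int n) * q u \<le> norm (B u)" for u
  proof -
    have "K powi (- 2 * int n) = inverse (K ^ (2 * n))"
      using power_int_minus[of K "int (2 * n)"] by (simp only: power_int_of_nat) simp
    moreover have "inverse (K ^ (2 * n)) * q u \<le> sqrt n * norm (A u)"
      using extremal_upper[OF A, of u] K_ge_1 by (simp add: field_simps)
    ultimately show ?thesis by (simp add: B_def)
  qed
  moreover have "norm (B u) \<le> sqrt (real n) * q u" for u
    using extremal_le[OF A, of u] by (simp add: B_def mult_left_mono)
  ultimately show ?thesis by blast
qed

end
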